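(* Let $k\ge 2$ be an integer and consider instances of Directed Multicut whose demand graph $H$ does not contain an induced $k$-matching-extension. Then the flow-cut gap (integrality gap of the distance LP) of every such instance is at most $k-1$, and there is a polynomial-time (randomized) rounding algorithm which, given a feasible solution $x$ of the distance LP, outputs a feasible multicut of expected weight at most $(k-1)\sum_{e} w_e x_e$.
   Context: Directed Multicut: the input is a directed supply graph $G=(V,E)$ with nonnegative edge weights $w_e$ and a directed demand graph $H=(V,F)$. A feasible solution is a set $E'\subseteq E$ such that for every $(s,t)\in F$ there is no directed path from $s$ to $t$ in $G-E'$; the goal is to minimize $\sum_{e\in E'} w_e$. The distance LP is: minimize $\sum_{e\in E} w_e x_e$ subject to $\sum_{e\in p} x_e \ge 1$ for every directed $s$-$t$ path $p$ in $G$ and every $(s,t)\in F$, and $x_e\ge 0$. A directed graph $H=(V,F)$ contains an induced $k$-matching-extension if there are sets $S=\{s_1,\dots,s_k\}\subseteq V$ and $T=\{t_1,\dots,t_k\}\subseteq V$ (the $s_i$ pairwise distinct, the $t_i$ pairwise distinct, though possibly $s_i=t_j$ for some $i\ne j$) such that (i) $(s_i,t_i)\in F$ for all $1\le i\le k$ and (ii) $(s_i,t_j)\notin F$ for all $i>j$. *)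

theory Defs
  imports
    "Graph_Theory.Pair_Digraph"
    "HOL-Probability.Probability_Mass_Function"
    "HOL-Computational_Algebra.Polynomial"
    "HOL-Library.Log_Nat"
    "HOL-Library.Extended_Real"
begin

section \<open>Directed Multicut and the distance LP\<close>

definition multicut_instance ::
    "'a pair_pre_digraph \<Rightarrow> 'a pair_pre_digraph \<Rightarrow> ('a \<times> 'a \<Rightarrow> real) \<Rightarrow> bool" where
  "multicut_instance G H w \<longleftrightarrow>
     pair_fin_digraph G \<and> pair_fin_digraph H \<and> pverts H = pverts G \<and> (\<forall>e\<in>parcs G. 0 \<le> w e)"

text \<open>
  Paths are the arc lists of \<^const>\<open>pre_digraph.apath\<close>; the empty list is a path from a vertex to
  itself. So if \<open>H\<close> has a loop, there is neither a feasible multicut nor a feasible LP solution.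
\<close>

definition feasible_multicut ::
    "'a pair_pre_digraph \<Rightarrow> 'a pair_pre_digraph \<Rightarrow> ('a \<times> 'a) set \<Rightarrow> bool" where
  "feasible_multicut G H E' \<longleftrightarrow>
     E' \<subseteq> parcs G \<and>
     (\<forall>(s, t)\<in>parcs H.
        \<not> (\<exists>p. pre_digraph.apath (with_proj (G\<lparr>parcs := parcs G - E'\<rparr>)) s p t))"

definition feasible_lp ::
    "'a pair_pre_digraph \<Rightarrow> 'a pair_pre_digraph \<Rightarrow> ('a \<times> 'a \<Rightarrow> real) \<Rightarrow> bool" where
  "feasible_lp G H x \<longleftrightarrow>
     (\<forall>(s, t)\<in>parcs H. \<forall>p. pre_digraph.apath (with_proj G) s p t \<longrightarrow> (\<Sum>e\<in>set p. x e) \<ge> 1) \<and>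
     (\<forall>e\<in>parcs G. x e \<ge> 0)"

definition cut_weight :: "('a \<times> 'a \<Rightarrow> real) \<Rightarrow> ('a \<times> 'a) set \<Rightarrow> real" where
  "cut_weight w E' = (\<Sum>e\<in>E'. w e)"

definition lp_cost ::
    "'a pair_pre_digraph \<Rightarrow> ('a \<times> 'a \<Rightarrow> real) \<Rightarrow> ('a \<times> 'a \<Rightarrow> real) \<Rightarrow> real" where
  "lp_cost G w x = (\<Sum>e\<in>parcs G. w e * x e)"

definition multicut_opt ::
    "'a pair_pre_digraph \<Rightarrow> 'a pair_pre_digraph \<Rightarrow> ('a \<times> 'a \<Rightarrow> real) \<Rightarrow> ereal" where
  "multicut_opt G H w = (INF E'\<in>{E'. feasible_multicut G H E'}. ereal (cut_weight w E'))"

definition lp_opt ::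
    "'a pair_pre_digraph \<Rightarrow> 'a pair_pre_digraph \<Rightarrow> ('a \<times> 'a \<Rightarrow> real) \<Rightarrow> ereal" where
  "lp_opt G H w = (INF x\<in>{x. feasible_lp G H x}. ereal (lp_cost G w x))"

text \<open>
  The quotient is taken in \<^typ>\<open>ereal\<close>, where \<open>a / 0 = \<infinity>\<close> for \<open>a > 0\<close> and \<open>0 / 0 = 0\<close>: a bound on the
  gap is a genuine constraint also if the optimum of the LP is 0.
\<close>

definition flow_cut_gap ::
    "'a pair_pre_digraph \<Rightarrow> 'a pair_pre_digraph \<Rightarrow> ('a \<times> 'a \<Rightarrow> real) \<Rightarrow> ereal" where
  "flow_cut_gap G H w = multicut_opt G H w / lp_opt G H w"

definition has_induced_matching_extension :: "nat \<Rightarrow> 'a pair_pre_digraph \<Rightarrow> bool" where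
  "has_induced_matching_extension k H \<longleftrightarrow>
     (\<exists>s t. s ` {1..k} \<subseteq> pverts H \<and> t ` {1..k} \<subseteq> pverts H \<and>
        inj_on s {1..k} \<and> inj_on t {1..k} \<and>
        (\<forall>i\<in>{1..k}. (s i, t i) \<in> parcs H) \<and>
        (\<forall>i\<in>{1..k}. \<forall>j\<in>{1..k}. i > j \<longrightarrow> (s i, t j) \<notin> parcs H))"


section \<open>A model of computation with logarithmic cost\<close>

text \<open>
  Programs are while programs over finitely many named unbounded arrays of rational numbers. An
  operation costs the number of bits of its result, so that the running time is polynomially
  related to the running time of a Turing machine.
\<close>

definition rat_size :: "rat \<Rightarrow> nat" where
  "rat_size r = (case quotient_of r of (a, b) \<Rightarrow> 1 + floorlog 2 (nat \<bar>a\<bar>) + floorlog 2 (nat b))"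

type_synonym store = "string \<Rightarrow> nat \<Rightarrow> rat"

datatype aexp =
    Const rat
  | Arr string aexp
  | Plus aexp aexp
  | Minus aexp aexp
  | Times aexp aexp
  | Divide aexp aexp

datatype bexp =
    Less aexp aexp
  | Neg bexp
  | Conj bexp bexp

datatype com =
    Skip
  | Assign string aexp aexp
  | Seq com com
  | Cond bexp com com
  | While bexp com

fun aval :: "aexp \<Rightarrow> store \<Rightarrow> rat" where
  "aval (Const c) s = c"
| "aval (Arr a e) s = s a (nat \<lfloor>aval e s\<rfloor>)"
| "aval (Plus e f) s = aval e s + aval f s"
| "aval (Minus e f) s = aval e s - aval f s"
| "aval (Times e f) s = aval e s * aval f s"
| "aval (Divide e f) s = aval e s / aval f s"

fun acost :: "aexp \<Rightarrow> store \<Rightarrow> nat" where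
  "acost (Const c) s = rat_size c"
| "acost (Arr a e) s = acost e s + rat_size (aval (Arr a e) s)"
| "acost (Plus e f) s = acost e s + acost f s + rat_size (aval (Plus e f) s)"
| "acost (Minus e f) s = acost e s + acost f s + rat_size (aval (Minus e f) s)"
| "acost (Times e f) s = acost e s + acost f s + rat_size (aval (Times e f) s)"
| "acost (Divide e f) s = acost e s + acost f s + rat_size (aval (Divide e f) s)"

fun bval :: "bexp \<Rightarrow> store \<Rightarrow> bool" where
  "bval (Less e f) s \<longleftrightarrow> aval e s < aval f s"
| "bval (Neg b) s \<longleftrightarrow> \<not> bval b s"
| "bval (Conj b c) s \<longleftrightarrow> bval b s \<and> bval c s"

fun bcost :: "bexp \<Rightarrow> store \<Rightarrow> nat" where
  "bcost (Less e f) s = acost e s + acost f s + 1"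
| "bcost (Neg b) s = bcost b s + 1"
| "bcost (Conj b c) s = bcost b s + bcost c s + 1"

text \<open>\<open>big_step c s t s'\<close>: started in \<open>s\<close>, the program \<open>c\<close> halts in \<open>s'\<close> after time \<open>t\<close>.
  \<open>Assign a e f\<close> stores the value of \<open>f\<close> in cell \<open>e\<close> of the array \<open>a\<close>.\<close>

inductive big_step :: "com \<Rightarrow> store \<Rightarrow> nat \<Rightarrow> store \<Rightarrow> bool" where
  Skip: "big_step Skip s 1 s"
| Assign: "big_step (Assign a e f) s (acost e s + acost f s + 1)
             (s(a := (s a)(nat \<lfloor>aval e s\<rfloor> := aval f s)))"
| Seq: "big_step c s t s' \<Longrightarrow> big_step d s' u s'' \<Longrightarrow> big_step (Seq c d) s (t + u) s''"
| CondTrue: "bval b s \<Longrightarrow> big_step c s t s' \<Longrightarrow> big_step (Cond b c d) s (bcost b s + t) s'"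
| CondFalse: "\<not> bval b s \<Longrightarrow> big_step d s t s' \<Longrightarrow> big_step (Cond b c d) s (bcost b s + t) s'"
| WhileFalse: "\<not> bval b s \<Longrightarrow> big_step (While b c) s (bcost b s) s"
| WhileTrue: "bval b s \<Longrightarrow> big_step c s t s' \<Longrightarrow> big_step (While b c) s' u s'' \<Longrightarrow>
    big_step (While b c) s (bcost b s + t + u) s''"

inductive_cases SkipE: "big_step Skip s t s'"
  and AssignE: "big_step (Assign a e f) s t s'"
  and SeqE: "big_step (Seq c d) s t s'"
  and CondE: "big_step (Cond b c d) s t s'"
  and WhileE: "big_step (While b c) s t s'"

lemma big_step_deterministic:
  "big_step c s t s' \<Longrightarrow> big_step c s u s'' \<Longrightarrow> u = t \<and> s'' = s'"
proof (induction arbitrary: u s'' rule: big_step.induct)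
  case Skip then show ?case by (auto elim: SkipE)
next
  case Assign then show ?case by (auto elim: AssignE)
next
  case Seq then show ?case by (metis SeqE)
next
  case CondTrue then show ?case by (metis CondE)
next
  case CondFalse then show ?case by (metis CondE)
next
  case WhileFalse then show ?case by (metis WhileE)
next
  case (WhileTrue b s c t s' u' s2)
  from WhileTrue.prems WhileTrue.hyps(1) obtain t1 s1 u1 where
    "u = bcost b s + t1 + u1" "big_step c s t1 s1" "big_step (While b c) s1 u1 s''"
    by (auto elim: WhileE)
  then show ?case using WhileTrue.IH by blast
qed


section \<open>Randomized polynomial-time rounding\<close>

text \<open>
  An instance with vertex set \<open>{..<n}\<close> and an LP solution are given as \<open>n \<times> n\<close> matrices, stored row
  by row, with rational entries. Cells not used by the input contain 0. The array \<open>coin\<close> holds the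
  random bits.
\<close>

definition matrix_cells :: "nat \<Rightarrow> (nat \<times> nat \<Rightarrow> rat) \<Rightarrow> nat \<Rightarrow> rat" where
  "matrix_cells n f i = (if i < n * n then f (i div n, i mod n) else 0)"

definition input_store ::
    "nat \<Rightarrow> nat pair_pre_digraph \<Rightarrow> nat pair_pre_digraph \<Rightarrow>
     (nat \<times> nat \<Rightarrow> rat) \<Rightarrow> (nat \<times> nat \<Rightarrow> rat) \<Rightarrow> bool list \<Rightarrow> store" where
  "input_store n G H w x r = (\<lambda>_ _. 0)
     (''n'' := (\<lambda>i. if i = 0 then of_nat n else 0),
      ''E'' := matrix_cells n (\<lambda>e. of_bool (e \<in> parcs G)),
      ''F'' := matrix_cells n (\<lambda>e. of_bool (e \<in> parcs H)),
      ''w'' := matrix_cells n (\<lambda>e. if e \<in> parcs G then w e else 0),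
      ''x'' := matrix_cells n (\<lambda>e. if e \<in> parcs G then x e else 0),
      ''coin'' := (\<lambda>i. of_bool (i < length r \<and> r ! i)))"

definition input_size ::
    "nat \<Rightarrow> nat pair_pre_digraph \<Rightarrow> nat pair_pre_digraph \<Rightarrow>
     (nat \<times> nat \<Rightarrow> rat) \<Rightarrow> (nat \<times> nat \<Rightarrow> rat) \<Rightarrow> nat" where
  "input_size n G H w x =
     (let s = input_store n G H w x [] in
      rat_size (s ''n'' 0) + (\<Sum>a\<in>{''E'', ''F'', ''w'', ''x''}. \<Sum>i<n * n. rat_size (s a i)))"

definition output_arcs :: "nat \<Rightarrow> store \<Rightarrow> (nat \<times> nat) set" where
  "output_arcs n s = {(i, j). i < n \<and> j < n \<and> s ''cut'' (i * n + j) \<noteq> 0}"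

text \<open>
  The program \<open>c\<close> runs in polynomial time in the worst case, using polynomially many uniformly random
  bits; on every instance whose demand graph satisfies \<open>P\<close> and every feasible LP solution it always
  produces a feasible multicut, of expected weight at most \<open>\<alpha>\<close> times the cost of the LP solution.
\<close>

definition randomized_poly_time_rounding ::
    "(nat pair_pre_digraph \<Rightarrow> bool) \<Rightarrow> real \<Rightarrow> com \<Rightarrow> bool" where
  "randomized_poly_time_rounding P \<alpha> c \<longleftrightarrow>
     (\<exists>p :: nat poly. \<forall>n G H w x.
        multicut_instance G H (\<lambda>e. of_rat (w e)) \<and> pverts G = {..<n} \<and> P H \<and>
        feasible_lp G H (\<lambda>e. of_rat (x e)) \<longrightarrow>
        (let q = poly p (input_size n G H w x) in
         \<exists>cut :: bool list \<Rightarrow> (nat \<times> nat) set.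
           (\<forall>r. length r = q \<longrightarrow>
              (\<exists>t s. big_step c (input_store n G H w x r) t s \<and> t \<le> q \<and> cut r = output_arcs n s) \<and>
              feasible_multicut G H (cut r)) \<and>
           measure_pmf.expectation (pmf_of_set {r. length r = q})
               (\<lambda>r. cut_weight (\<lambda>e. of_rat (w e)) (cut r))
             \<le> \<alpha> * lp_cost G (\<lambda>e. of_rat (w e)) (\<lambda>e. of_rat (x e))))"

end

theory Submission
  imports Defs "HOL-Analysis.Analysis"
begin

text \<open>
  Let \<open>d\<close> be the distance of the LP solution \<open>x\<close>, capped at 1. For a radius \<open>0 \<le> \<theta> < 1\<close> cut the arc \<open>(a, b)\<close>
  iff there is a sink \<open>t\<close> such that some source of \<open>t\<close> is within distance \<open>\<theta>\<close> of \<open>a\<close> but no source of \<open>t\<close> is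
  within distance \<open>\<theta>\<close> of \<open>b\<close>. Along uncut arcs, "some source of \<open>t\<close> is within distance \<open>\<theta>\<close>" is preserved;
  it holds at every source of \<open>t\<close> and fails at \<open>t\<close>, so the cut is feasible. If the radii that cut \<open>(a, b)\<close> had
  measure more than \<open>(k - 1) x(a, b)\<close>, there would be \<open>k\<close> of them with gaps at least \<open>x(a, b)\<close>, and the
  corresponding sources and sinks would form an induced \<open>k\<close>-matching-extension. Averaging over \<open>\<theta>\<close> gives a
  cut of weight at most \<open>k - 1\<close> times the cost of \<open>x\<close>.

  The cut only changes when \<open>\<theta>\<close> passes a value of \<open>d\<close>, so it suffices to try these at most \<open>n\<^sup>2\<close> radii and to
  keep the lightest cut. This derandomizes the rounding; in particular, the random bits are never read.
\<close>

section \<open>Threshold cuts\<close>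

text \<open>The cut treats each sink separately but pools all of its sources. That \<open>b\<close>
  is out of reach for a sink \<open>t\<close> is a statement about every source of \<open>t\<close>,
  and this universal quantifier is what produces the non-demands of an induced matching extension: a
  source chosen at a small radius cannot also be a source of a sink chosen at a radius larger by
  \<open>x (a, b)\<close>. The algorithmic half is shaped by the logarithmic cost. An arithmetic
  operation may double the size of numbers, so estimating \<open>n\<close> rounds of a shortest-path
  recursion operation by operation would allow exponentially long entries. Sizes are therefore
  bounded through invariants of the values: with \<open>M\<close> the product of all denominators of
  \<open>x\<close>, every distance is a multiple of \<open>1 / M\<close> in the interval from 0 to
  1, in every round. The partial sums of arc weights are controlled by the product of the
  denominators of \<open>w\<close> in the same way.\<close>

lemma feasible_lp_walk:
  assumes G: "pair_fin_digraph G" and lp: "feasible_lp G H x"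
    and "(s, t) \<in> parcs H" "s \<in> pverts G" "set p \<subseteq> parcs G" "pcas s p t"
  shows "1 \<le> sum_list (map x p)"
proof -
  interpret pair_fin_digraph G by fact
  have aw: "awalk s p t"
    using assms by (simp add: awalk_def)
  \<comment> \<open>The LP constrains only paths without repeated vertices and counts each arc once.
    Shortcutting the walk to \<open>?q\<close> meets the constraint; restoring the omitted arcs and
    the multiplicities only increases the sum, as \<open>x\<close> is nonnegative.\<close>
  let ?q = "awalk_to_apath p"
  have nn: "0 \<le> x e" if "e \<in> set p" for e
    using that lp assms(5) by (auto simp: feasible_lp_def)
  have "apath s ?q t" by (rule apath_awalk_to_apath[OF aw])
  then have "1 \<le> (\<Sum>e\<in>set ?q. x e)"
    using lp assms(3) unfolding feasible_lp_def by blast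
  also have "\<dots> \<le> (\<Sum>e\<in>set p. x e)"
    using awalk_to_apath_subset[OF aw] nn by (intro sum_mono2) auto
  also have "\<dots> \<le> sum_list (map x p)"
    using nn
  proof (induction p)
    case (Cons e p)
    then have "(\<Sum>e\<in>set (e # p). x e) \<le> x e + (\<Sum>e\<in>set p. x e)"
      by (cases "e \<in> set p") (auto simp: insert_absorb)
    with Cons show ?case by fastforce
  qed simp
  finally show ?thesis .
qed

text \<open>The element 1 keeps the set nonempty when \<open>v\<close> is unreachable, and the cap
  is invisible to radii below 1. Walks instead of paths allow an arc to be appended freely.\<close>

definition capped_distance ::
    "'a pair_pre_digraph \<Rightarrow> ('a \<times> 'a \<Rightarrow> real) \<Rightarrow> 'a \<Rightarrow> 'a \<Rightarrow> real" where
  "capped_distance G x u v =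
     Inf (insert 1 {sum_list (map x p) | p. set p \<subseteq> parcs G \<and> pcas u p v})"

definition threshold_cut ::
    "'a pair_pre_digraph \<Rightarrow> 'a pair_pre_digraph \<Rightarrow> ('a \<Rightarrow> 'a \<Rightarrow> real) \<Rightarrow> real \<Rightarrow> ('a \<times> 'a) set" where
  "threshold_cut G H d \<theta> =
     {(a, b) \<in> parcs G. \<exists>t. (\<exists>s. (s, t) \<in> parcs H \<and> d s a \<le> \<theta>) \<and>
                              (\<forall>s. (s, t) \<in> parcs H \<longrightarrow> \<theta> < d s b)}"

text \<open>The distance \<open>d\<close> is abstract so that one analysis serves both the infimum
  \<open>capped_distance\<close>, for real \<open>x\<close>, and the table that the program computes
  from rational input.\<close>

locale lp_distance =
  fixes G H :: "'a pair_pre_digraph" and x :: "'a \<times> 'a \<Rightarrow> real" and d :: "'a \<Rightarrow> 'a \<Rightarrow> real"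
  assumes fin_G: "pair_fin_digraph G" and fin_H: "pair_fin_digraph H"
    and verts_eq: "pverts H = pverts G"
    and dist_self: "v \<in> pverts G \<Longrightarrow> d v v = 0"
    and dist_arc: "s \<in> pverts G \<Longrightarrow> (a, b) \<in> parcs G \<Longrightarrow> d s b \<le> d s a + x (a, b)"
    and dist_demand: "(s, t) \<in> parcs H \<Longrightarrow> 1 \<le> d s t"
begin

lemma finite_arcs: "finite (parcs G)" "finite (parcs H)"
  using fin_G fin_H by (auto simp: pair_fin_digraph_def pair_fin_digraph_axioms_def)

lemma demand_verts: "(s, t) \<in> parcs H \<Longrightarrow> s \<in> pverts G \<and> t \<in> pverts G"
  using fin_H verts_eq
  by (auto simp: pair_fin_digraph_def pair_wf_digraph_def)

lemma threshold_cut_feasible: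
  assumes "0 \<le> \<theta>" "\<theta> < 1"
  shows "feasible_multicut G H (threshold_cut G H d \<theta>)"
  unfolding feasible_multicut_def
proof (intro conjI ballI, goal_cases)
  case 1
  then show ?case by (auto simp: threshold_cut_def)
next
  case (2 st)
  obtain s t where st: "st = (s, t)" by force
  have "\<not> pre_digraph.apath (with_proj (G\<lparr>parcs := parcs G - threshold_cut G H d \<theta>\<rparr>)) s p t" for p
  proof
    assume "pre_digraph.apath (with_proj (G\<lparr>parcs := parcs G - threshold_cut G H d \<theta>\<rparr>)) s p t"
    then have p: "set p \<subseteq> parcs G - threshold_cut G H d \<theta>" "pcas s p t"
      by (auto simp: pre_digraph.apath_def pre_digraph.awalk_def cas_with_proj_eq)
    have "\<exists>s. (s, t) \<in> parcs H \<and> d s t \<le> \<theta>"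
      if "set p \<subseteq> parcs G - threshold_cut G H d \<theta>" "pcas u p t"
        "\<exists>s. (s, t) \<in> parcs H \<and> d s u \<le> \<theta>" for u
      using that
    proof (induction p arbitrary: u)
      case (Cons e p)
      then have e: "e \<in> parcs G" "e \<notin> threshold_cut G H d \<theta>" "fst e = u" "pcas (snd e) p t"
        by auto
      have "\<exists>s. (s, t) \<in> parcs H \<and> d s (snd e) \<le> \<theta>"
        using e Cons.prems(3) unfolding threshold_cut_def by (cases e) force
      with Cons e show ?case by auto
    qed auto
    moreover have "\<exists>s'. (s', t) \<in> parcs H \<and> d s' s \<le> \<theta>"
      using 2 st demand_verts dist_self assms by force
    ultimately show False
      using p dist_demand assms(2) by fastforce
  qed
  then show ?case using st by simp
qed

text \<open>If \<open>(s i, t j)\<close> with \<open>i < j\<close> were a demand, the sink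
  \<open>t j\<close> would force \<open>\<theta> j < d (s i) b\<close>, whereas the arc gives
  \<open>d (s i) b \<le> d (s i) a + x (a, b) \<le> \<theta> i + x (a, b) \<le> \<theta>
  j\<close>.\<close>

lemma spaced_points_matching_extension:
  assumes ab: "(a, b) \<in> parcs G"
    and mem: "\<And>i. i < k \<Longrightarrow> (a, b) \<in> threshold_cut G H d (\<theta> i)"
    and sp: "\<And>i j. i < j \<Longrightarrow> j < k \<Longrightarrow> \<theta> i + x (a, b) \<le> \<theta> j"
  shows "has_induced_matching_extension k H"
proof -
  have "\<forall>i. \<exists>s t. i < k \<longrightarrow> (s, t) \<in> parcs H \<and> d s a \<le> \<theta> i \<and>
          (\<forall>s. (s, t) \<in> parcs H \<longrightarrow> \<theta> i < d s b)"
    using mem unfolding threshold_cut_def by blast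
  then obtain s t where st: "\<And>i. i < k \<Longrightarrow> (s i, t i) \<in> parcs H" "\<And>i. i < k \<Longrightarrow> d (s i) a \<le> \<theta> i"
    "\<And>i r. i < k \<Longrightarrow> (r, t i) \<in> parcs H \<Longrightarrow> \<theta> i < d r b"
    by metis
  have non: "(s i, t j) \<notin> parcs H" if "i < j" "j < k" for i j
  proof
    assume "(s i, t j) \<in> parcs H"
    then have "\<theta> j < d (s i) b" using st(3) that by blast
    moreover have "d (s i) b \<le> d (s i) a + x (a, b)"
      using st(1)[of i] that demand_verts ab by (intro dist_arc) auto
    moreover have "d (s i) a \<le> \<theta> i" using st(2)[of i] that by simp
    ultimately show False using sp[OF that] by linarith
  qed
  \<comment> \<open>A coincidence of sources or of sinks would turn the non-demand
    \<open>(s i, t j)\<close> into one of the demands \<open>(s j, t j)\<close> and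
    \<open>(s i, t i)\<close>.\<close>
  have inj: "s i \<noteq> s j \<and> t i \<noteq> t j" if "i < j" "j < k" for i j
    using non[OF that] st(1)[of i] st(1)[of j] that by auto
  then have inj': "s i \<noteq> s j \<and> t i \<noteq> t j" if "i \<noteq> j" "j < k" "i < k" for i j
    using that by (metis linorder_neqE_nat)
  \<comment> \<open>The definition forbids demands for \<open>i > j\<close> on the indices 1 to
    \<open>k\<close>, while \<open>non\<close> excludes them for \<open>i < j\<close> on 0 to
    \<open>k - 1\<close>. Hence the reversal \<open>k - i\<close>.\<close>
  show ?thesis
    unfolding has_induced_matching_extension_def
  proof (rule exI[of _ "\<lambda>i. s (k - i)"], rule exI[of _ "\<lambda>i. t (k - i)"],
      intro conjI ballI impI)
    have ne: "s (k - i) \<noteq> s (k - j) \<and> t (k - i) \<noteq> t (k - j)"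
      if "i \<in> {1..k}" "j \<in> {1..k}" "i \<noteq> j" for i j
      using that by (intro inj') auto
    then show "inj_on (\<lambda>i. s (k - i)) {1..k}" "inj_on (\<lambda>i. t (k - i)) {1..k}"
      by (meson inj_onI)+
    show "(\<lambda>i. s (k - i)) ` {1..k} \<subseteq> pverts H" "(\<lambda>i. t (k - i)) ` {1..k} \<subseteq> pverts H"
      using demand_verts[OF st(1)] verts_eq by auto
  qed (use st(1) non in auto)
qed

end

text \<open>Greedy choice from the left: take a point near the infimum and discard what lies too
  close to it. Each further point costs little more than \<open>\<delta>\<close> of measure, so
  \<open>m + 1\<close> points fit into measure exceeding \<open>m * \<delta>\<close>.\<close>

lemma spaced_points_in_measurable_set:
  fixes U :: "real set"
  assumes "U \<in> sets lborel" "bdd_below U" "emeasure lborel U < \<infinity>" "measure lborel U > real m * \<delta>" "0 \<le> \<delta>"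
  shows "\<exists>\<theta>. (\<forall>i\<le>m. \<theta> i \<in> U) \<and> (\<forall>i j. i < j \<longrightarrow> j \<le> m \<longrightarrow> \<theta> i + \<delta> \<le> \<theta> j)"
  using assms
proof (induction m arbitrary: U)
  case 0
  then have "U \<noteq> {}" by auto
  then show ?case by auto
next
  case (Suc m)
  \<comment> \<open>The infimum need not belong to \<open>U\<close>, so the first point may lie up
    to \<open>\<epsilon>\<close> above it and a strip of length \<open>\<delta> + \<epsilon>\<close>
    is removed. Half of the excess measure is small enough to leave more than
    \<open>m * \<delta>\<close>.\<close>
  define \<epsilon> where "\<epsilon> = (measure lborel U - real (Suc m) * \<delta>) / 2"
  have \<epsilon>: "\<epsilon> > 0" "measure lborel U - \<epsilon> > real (Suc m) * \<delta>"
    using Suc.prems by (auto simp: \<epsilon>_def field_simps)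
  have "0 \<le> real (Suc m) * \<delta>" using Suc.prems by simp
  then have "measure lborel U > 0" using Suc.prems(4) by linarith
  then have ne: "U \<noteq> {}" by auto
  define l where "l = Inf U"
  obtain \<theta>0 where \<theta>0: "\<theta>0 \<in> U" "\<theta>0 < l + \<epsilon>"
    using cInf_lessD[OF ne, of "l + \<epsilon>"] \<epsilon> l_def by auto
  define U' where "U' = U \<inter> {l + \<delta> + \<epsilon>..}"
  have U'U: "U' \<subseteq> U" by (auto simp: U'_def)
  have m': "U' \<in> sets lborel" using Suc.prems by (auto simp: U'_def)
  have e': "emeasure lborel U' < \<infinity>"
    using emeasure_mono[OF U'U, of lborel] Suc.prems by (auto simp: order_le_less_trans)
  have fm: "U' \<in> fmeasurable lborel" "{l..l+\<delta>+\<epsilon>} \<in> fmeasurable lborel" "U \<in> fmeasurable lborel"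
    using m' e' Suc.prems by (auto simp: fmeasurable_def emeasure_lborel_Icc_eq)
  have "U \<subseteq> U' \<union> {l..l+\<delta>+\<epsilon>}"
    using Suc.prems(2) by (auto simp: U'_def l_def intro: cInf_lower)
  then have "measure lborel U \<le> measure lborel (U' \<union> {l..l+\<delta>+\<epsilon>})"
    using fm by (intro measure_mono_fmeasurable) auto
  also have "\<dots> \<le> measure lborel U' + measure lborel {l..l+\<delta>+\<epsilon>}"
    using fm by (intro measure_Un_le) auto
  also have "measure lborel {l..l+\<delta>+\<epsilon>} = \<delta> + \<epsilon>"
    using \<epsilon> Suc.prems by simp
  finally have "measure lborel U' > real m * \<delta>"
    using \<epsilon> by (simp add: algebra_simps)
  moreover have "bdd_below U'" using Suc.prems(2) U'U by (rule bdd_below_mono)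
  ultimately obtain \<theta> where \<theta>: "\<forall>i\<le>m. \<theta> i \<in> U'" "\<forall>i j. i < j \<longrightarrow> j \<le> m \<longrightarrow> \<theta> i + \<delta> \<le> \<theta> j"
    using Suc.IH[OF m' _ e'] Suc.prems by blast
  define \<theta>' where "\<theta>' i = (case i of 0 \<Rightarrow> \<theta>0 | Suc i \<Rightarrow> \<theta> i)" for i
  have "\<theta>' i \<in> U" if "i \<le> Suc m" for i
    using that \<theta>(1) \<theta>0 U'U by (auto simp: \<theta>'_def split: nat.splits)
  moreover have "\<theta>' i + \<delta> \<le> \<theta>' j" if ij: "i < j" "j \<le> Suc m" for i j
  proof -
    obtain j' where j: "j = Suc j'" using ij by (cases j) auto
    have "l + \<delta> + \<epsilon> \<le> \<theta> j'" using \<theta>(1) ij j by (auto simp: U'_def)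
    with ij \<theta>(2) \<theta>0 j show ?thesis by (auto simp: \<theta>'_def split: nat.splits)
  qed
  ultimately show ?case by blast
qed

context lp_distance
begin

text \<open>For a uniform radius the expected weight of the cut is the sum of \<open>w e\<close>
  times the measure of \<open>S e\<close>, and each measure is at most \<open>(k - 1) * x e\<close>.
  Some radius does no worse than the average.\<close>

lemma cheap_threshold_exists:
  assumes nn: "\<And>e. e \<in> parcs G \<Longrightarrow> 0 \<le> w e \<and> 0 \<le> x e"
    and k: "k \<ge> 1" and free: "\<not> has_induced_matching_extension k H"
  shows "\<exists>\<theta>. 0 \<le> \<theta> \<and> \<theta> < 1 \<and>
    cut_weight w (threshold_cut G H d \<theta>) \<le> (real k - 1) * lp_cost G w x"
proof (rule ccontr)
  let ?C = "threshold_cut G H d"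
  assume "\<not> ?thesis"
  then have big: "(real k - 1) * lp_cost G w x < cut_weight w (?C \<theta>)" if "0 \<le> \<theta>" "\<theta> < 1" for \<theta>
    using that by (meson not_le)
  define S where "S e = {\<theta>. 0 \<le> \<theta> \<and> \<theta> < 1 \<and> e \<in> ?C \<theta>}" for e
  define T where "T = snd ` parcs H"
  define N where "N t = {s. (s, t) \<in> parcs H}" for t
  have finT: "finite T" using finite_arcs by (simp add: T_def)
  have finN: "finite (N t)" for t
    using finite_subset[of "N t" "fst ` parcs H"] finite_arcs by (force simp: N_def)
  \<comment> \<open>This form exhibits \<open>S (a, b)\<close> as a finite Boolean combination of
    intervals, hence measurable.\<close>
  have S_eq: "S (a, b) = {0..<1} \<inter> (\<Union>t\<in>T. (\<Union>s\<in>N t. {d s a..}) - (\<Union>s\<in>N t. {d s b..}))"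
    if "(a, b) \<in> parcs G" for a b
  proof -
    have "(\<exists>t. (\<exists>s. (s, t) \<in> parcs H \<and> d s a \<le> \<theta>) \<and> (\<forall>s. (s, t) \<in> parcs H \<longrightarrow> \<theta> < d s b)) \<longleftrightarrow>
      (\<exists>t\<in>T. (\<exists>s\<in>N t. d s a \<le> \<theta>) \<and> \<not> (\<exists>s\<in>N t. d s b \<le> \<theta>))" for \<theta>
      unfolding T_def N_def by (simp add: not_le image_iff Bex_def) (metis snd_conv)
    then show ?thesis using that by (auto simp: S_def threshold_cut_def)
  qed
  have meas: "S e \<in> sets lborel" if "e \<in> parcs G" for e
    using S_eq[of "fst e" "snd e"] that finT finN by auto
  have Ssub: "S e \<subseteq> {0..<1}" for e by (auto simp: S_def)
  have em: "emeasure lborel (S e) < \<infinity>" for e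
  proof -
    have "emeasure lborel (S e) \<le> emeasure lborel {0..<1::real}"
      by (rule emeasure_mono) (use Ssub in auto)
    then show ?thesis by (simp add: order_le_less_trans)
  qed
  \<comment> \<open>The spacing lemma is used with \<open>m = k - 1\<close>, which yields the
    \<open>k\<close> radii of a forbidden extension.\<close>
  have mS: "measure lborel (S e) \<le> (real k - 1) * x e" if e_in: "e \<in> parcs G" for e
  proof (rule ccontr)
    assume "\<not> ?thesis"
    then have "measure lborel (S e) > real (k - 1) * x e" using k by (simp add: of_nat_diff)
    moreover have "bdd_below (S e)" using Ssub[of e] by (meson bdd_below_Ico bdd_below_mono)
    ultimately obtain \<theta> where \<theta>: "\<forall>i\<le>k - 1. \<theta> i \<in> S e"
        "\<forall>i j. i < j \<longrightarrow> j \<le> k - 1 \<longrightarrow> \<theta> i + x e \<le> \<theta> j"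
      using spaced_points_in_measurable_set[OF meas[OF e_in] _ em, of "k - 1" "x e"] nn e_in by blast
    obtain a b where e: "e = (a, b)" by force
    have "has_induced_matching_extension k H"
      by (rule spaced_points_matching_extension[of a b k \<theta>])
        (use \<theta> e_in e k in \<open>auto simp: S_def\<close>)
    with free show False ..
  qed
  define W where "W \<theta> = (\<Sum>e\<in>parcs G. w e * indicator (S e) \<theta>)" for \<theta>
  have W_eq: "W \<theta> = cut_weight w (?C \<theta>)" if "0 \<le> \<theta>" "\<theta> < 1" for \<theta>
  proof -
    have "W \<theta> = (\<Sum>e\<in>parcs G. if e \<in> ?C \<theta> then w e else 0)"
      unfolding W_def using that by (intro sum.cong) (auto simp: S_def indicator_def)
    also have "\<dots> = (\<Sum>e\<in>parcs G \<inter> ?C \<theta>. w e)"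
      using finite_arcs by (simp add: sum.inter_restrict)
    also have "parcs G \<inter> ?C \<theta> = ?C \<theta>" by (auto simp: threshold_cut_def)
    finally show ?thesis by (simp add: cut_weight_def)
  qed
  have "?C ` {0..<1} \<subseteq> Pow (parcs G)" by (auto simp: threshold_cut_def)
  then have fin: "finite (?C ` {0..<1})"
    using finite_arcs finite_subset by blast
  \<comment> \<open>Only finitely many cuts occur, so the assumed strict inequality also holds for
    their minimum weight. As a constant lower bound on \<open>W\<close>, it keeps the inequality
    strict after integration.\<close>
  define m where "m = Min (cut_weight w ` ?C ` {0..<1})"
  have "m \<in> cut_weight w ` ?C ` {0..<1}"
    unfolding m_def by (rule Min_in) (use fin in auto)
  then have m_big: "m > (real k - 1) * lp_cost G w x" using big by auto
  have m_le: "m \<le> W \<theta>" if "0 \<le> \<theta>" "\<theta> < 1" for \<theta>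
    unfolding W_eq[OF that] m_def by (rule Min_le) (use fin that in auto)
  have int: "integrable lborel (\<lambda>\<theta>. w e * indicator (S e) \<theta> :: real)" if "e \<in> parcs G" for e
    using meas[OF that] em by (intro integrable_mult_right integrable_real_indicator) auto
  have "m = (LINT \<theta>|lborel. m * indicator {0..<1::real} \<theta>)"
    by simp
  also have "\<dots> \<le> (LINT \<theta>|lborel. W \<theta>)"
  proof (rule integral_mono)
    show "integrable lborel (\<lambda>\<theta>. m * indicator {0..<1::real} \<theta>)"
      by (intro integrable_mult_right integrable_real_indicator) auto
    show "integrable lborel W"
      unfolding W_def using int by (intro Bochner_Integration.integrable_sum) auto
    show "m * indicator {0..<1} \<theta> \<le> W \<theta>" for \<theta>
      using m_le[of \<theta>] nn by (auto simp: indicator_def W_def intro!: sum_nonneg)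
  qed
  also have "\<dots> = (\<Sum>e\<in>parcs G. w e * measure lborel (S e))"
    unfolding W_def using int meas by (subst Bochner_Integration.integral_sum) auto
  also have "\<dots> \<le> (\<Sum>e\<in>parcs G. w e * ((real k - 1) * x e))"
    using mS nn by (intro sum_mono mult_left_mono) auto
  also have "\<dots> = (real k - 1) * lp_cost G w x"
    by (simp add: lp_cost_def sum_distrib_left algebra_simps)
  finally show False using m_big by simp
qed

end

section \<open>The flow-cut gap\<close>

lemma lp_distance_capped:
  assumes inst: "multicut_instance G H w" and lp: "feasible_lp G H x"
  shows "lp_distance G H x (capped_distance G x)"
proof -
  let ?P = "\<lambda>u v. insert 1 {sum_list (map x p) | p. set p \<subseteq> parcs G \<and> pcas u p v}"
  have nn: "0 \<le> z" if "z \<in> ?P u v" for z u v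
    using that lp unfolding feasible_lp_def by (fastforce intro!: sum_list_nonneg)
  then have bdd: "bdd_below (?P u v)" for u v by (meson bdd_belowI)
  interpret H: pair_fin_digraph H using inst by (simp add: multicut_instance_def)
  show ?thesis
  proof (intro lp_distance.intro)
    fix v
    have "0 \<in> ?P v v" by (auto intro!: exI[of _ "[]"])
    then show "capped_distance G x v v = 0"
      unfolding capped_distance_def using nn by (intro cInf_eq_minimum) blast+
  next
    fix s a b assume "(a, b) \<in> parcs G"
    have "capped_distance G x s b - x (a, b) \<le> capped_distance G x s a"
      unfolding capped_distance_def
    proof (rule cInf_greatest)
      fix z assume "z \<in> ?P s a"
      then consider "z = 1" | p where "z = sum_list (map x p)" "set p \<subseteq> parcs G" "pcas s p a" by auto
      then show "Inf (?P s b) - x (a, b) \<le> z"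
      proof cases
        case 1
        have "Inf (?P s b) \<le> 1" by (rule cInf_lower[OF _ bdd]) simp
        moreover have "0 \<le> x (a, b)" using \<open>(a, b) \<in> _\<close> lp by (auto simp: feasible_lp_def)
        ultimately show ?thesis using 1 by simp
      next
        case 2
        have "pcas s (p @ [(a, b)]) b"
          using 2(3) by (induction p arbitrary: s) auto
        then have "sum_list (map x (p @ [(a, b)])) \<in> ?P s b"
          using 2 \<open>(a, b) \<in> _\<close> by (auto intro!: exI[of _ "p @ [(a, b)]"] simp del: map_append sum_list_append)
        then have "Inf (?P s b) \<le> sum_list (map x (p @ [(a, b)]))" by (rule cInf_lower[OF _ bdd])
        with 2 show ?thesis by simp
      qed
    qed simp
    then show "capped_distance G x s b \<le> capped_distance G x s a + x (a, b)" by simp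
  next
    fix s t assume st: "(s, t) \<in> parcs H"
    then have "s \<in> pverts G" using inst H.in_arcsD1 by (auto simp: multicut_instance_def)
    then show "1 \<le> capped_distance G x s t"
      unfolding capped_distance_def using feasible_lp_walk[OF _ lp st] inst
      by (intro cInf_greatest) (auto simp: multicut_instance_def)
  qed (use inst in \<open>auto simp: multicut_instance_def\<close>)
qed

lemma flow_cut_gap_le:
  assumes k: "k \<ge> 2" and inst: "multicut_instance G H w"
    and free: "\<not> has_induced_matching_extension k H"
  shows "flow_cut_gap G H w \<le> ereal (real k - 1)"
proof -
  have opt_le: "multicut_opt G H w \<le> ereal (real k - 1) * ereal (lp_cost G w x)"
    if lp: "feasible_lp G H x" for x
  proof -
    interpret lp_distance G H x "capped_distance G x" by (rule lp_distance_capped[OF inst lp])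
    have "0 \<le> w e \<and> 0 \<le> x e" if "e \<in> parcs G" for e
      using inst lp that by (auto simp: multicut_instance_def feasible_lp_def)
    then obtain \<theta> where "0 \<le> \<theta>" "\<theta> < 1" and
      le: "cut_weight w (threshold_cut G H (capped_distance G x) \<theta>) \<le> (real k - 1) * lp_cost G w x"
      using cheap_threshold_exists[of w k] k free by auto
    then have "multicut_opt G H w \<le> ereal (cut_weight w (threshold_cut G H (capped_distance G x) \<theta>))"
      unfolding multicut_opt_def using threshold_cut_feasible by (intro INF_lower) auto
    with le show ?thesis by (simp add: order_trans)
  qed
  have lp_nonneg: "0 \<le> lp_cost G w x" if "feasible_lp G H x" for x
    using that inst by (auto simp: feasible_lp_def multicut_instance_def lp_cost_def intro!: sum_nonneg)
  show ?thesis
  proof (cases "\<exists>x. feasible_lp G H x")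
    case False
    \<comment> \<open>Without a feasible LP solution the gap is a quotient by
      \<open>\<infinity>\<close>, which is 0 in \<open>ereal\<close>.\<close>
    then have "lp_opt G H w = \<infinity>" by (simp add: lp_opt_def top_ereal_def)
    then show ?thesis using k by (simp add: flow_cut_gap_def)
  next
    case True
    have mc_nonneg: "0 \<le> multicut_opt G H w"
      unfolding multicut_opt_def using inst
      by (intro INF_greatest)
        (auto simp: cut_weight_def feasible_multicut_def multicut_instance_def intro!: sum_nonneg)
    \<comment> \<open>With the positive constant \<open>k - 1\<close> moved to the left, the bounds
      for the single solutions \<open>x\<close> combine to a bound on the infimum.\<close>
    have "multicut_opt G H w / ereal (real k - 1) \<le> lp_opt G H w"
      unfolding lp_opt_def
    proof (rule INF_greatest)
      fix x assume "x \<in> {x. feasible_lp G H x}"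
      then show "multicut_opt G H w / ereal (real k - 1) \<le> ereal (lp_cost G w x)"
        using opt_le[of x] k by (auto intro!: ereal_divide_le_pos[THEN iffD2] simp: mult.commute)
    qed
    then have le: "multicut_opt G H w \<le> ereal (real k - 1) * lp_opt G H w"
      using k by (simp add: ereal_divide_le_pos)
    have lp0: "0 \<le> lp_opt G H w" unfolding lp_opt_def using lp_nonneg by (intro INF_greatest) auto
    show ?thesis
    proof (cases "lp_opt G H w = 0")
      case True
      \<comment> \<open>Both optima vanish, and \<open>0 / 0 = 0\<close> in
        \<open>ereal\<close>.\<close>
      with le mc_nonneg have "multicut_opt G H w = 0" by simp
      then show ?thesis using k by (simp add: flow_cut_gap_def)
    next
      case False
      obtain x where x: "feasible_lp G H x" using \<open>\<exists>x. _\<close> by blast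
      have "lp_opt G H w \<le> ereal (lp_cost G w x)" unfolding lp_opt_def using x by (intro INF_lower) auto
      then have "lp_opt G H w \<noteq> \<infinity>" by auto
      with False lp0 have "0 < lp_opt G H w" "lp_opt G H w \<noteq> \<infinity>" by auto
      then show ?thesis unfolding flow_cut_gap_def using le
        by (simp add: ereal_divide_le_pos mult.commute)
    qed
  qed
qed

section \<open>Sizes of rational numbers\<close>

lemma floorlog_mult_le: "floorlog 2 (a * b) \<le> floorlog 2 a + floorlog 2 b"
proof (cases "a = 0 \<or> b = 0")
  case True
  then show ?thesis by (auto simp: floorlog_def)
next
  case False
  have "a * b < 2 ^ floorlog 2 a * 2 ^ floorlog 2 b"
    using floorlog_bounds[of a 2] floorlog_bounds[of b 2] False by (intro mult_strict_mono) auto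
  then show ?thesis by (intro floorlog_leI) (auto simp: power_add)
qed

lemma floorlog_add_le: "floorlog 2 (a + b) \<le> Suc (max (floorlog 2 a) (floorlog 2 b))"
proof -
  let ?m = "max (floorlog 2 a) (floorlog 2 b)"
  have "a < 2 ^ ?m" "b < 2 ^ ?m" by (rule floorlog_leD; simp)+
  then show ?thesis by (intro floorlog_leI) auto
qed

lemma floorlog_le_self: "floorlog 2 n \<le> n"
  by (rule floorlog_leI) (auto simp: less_exp)

text \<open>The summand 1 is the bit length of the empty product.\<close>

lemma floorlog_prod_le:
  "finite I \<Longrightarrow> floorlog 2 (\<Prod>i\<in>I. f i) \<le> 1 + (\<Sum>i\<in>I. floorlog 2 (f i))"
proof (induction I rule: finite_induct)
  case empty
  then show ?case by (simp add: floorlog_def)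
next
  case (insert i I)
  then show ?case using floorlog_mult_le[of "f i" "\<Prod>i\<in>I. f i"] by simp
qed

text \<open>The reduced numerator divides \<open>p\<close> and the reduced denominator divides
  \<open>q\<close>, so cancelling can only shorten a representation.\<close>

lemma rat_size_quotient_le:
  assumes "q \<noteq> 0"
  shows "rat_size (of_int p / of_int q) \<le> 1 + floorlog 2 (nat \<bar>p\<bar>) + floorlog 2 (nat \<bar>q\<bar>)"
proof -
  obtain a b where ab: "quotient_of (of_int p / of_int q) = (a, b)" by force
  have b: "b > 0" and cop: "coprime a b"
    using ab quotient_of_denom_pos quotient_of_coprime by blast+
  have "of_int p / of_int q = (of_int a / of_int b :: rat)" using quotient_of_div[OF ab] .
  then have "(of_int (p * b) :: rat) = of_int (a * q)"
    using b assms by (simp add: field_simps)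
  then have eq: "p * b = a * q" by (simp only: of_int_eq_iff)
  have "b dvd q" using cop eq by (metis coprime_commute coprime_dvd_mult_right_iff dvd_triv_right)
  then have "b \<le> \<bar>q\<bar>" using assms b by (simp add: zdvd_imp_le)
  have "a dvd p" using cop eq by (metis coprime_dvd_mult_left_iff dvd_triv_left)
  then have "\<bar>a\<bar> \<le> \<bar>p\<bar>"
  proof (cases "p = 0")
    case True
    with eq assms show ?thesis by simp
  next
    case False
    with \<open>a dvd p\<close> show ?thesis by (simp add: dvd_imp_le_int)
  qed
  show ?thesis
    unfolding rat_size_def ab using \<open>\<bar>a\<bar> \<le> _\<close> \<open>b \<le> _\<close>
    by (auto intro!: add_mono floorlog_mono)
qed

lemma rat_size_pos: "1 \<le> rat_size r"
  by (simp add: rat_size_def split: prod.splits)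

lemma rat_size_of_nat_le: "rat_size (of_nat m) \<le> m + 2"
  using rat_size_quotient_le[of 1 "int m"] floorlog_le_self[of m] by (simp add: floorlog_def)

text \<open>Before reduction, the denominator of a result has at most the added lengths of its two
  factors, and so has the numerator up to one carry bit. Division by zero gives 0 and is treated
  apart.\<close>

lemma rat_size_arith_le:
  "rat_size (r + s) \<le> 2 * (rat_size r + rat_size s)"
  "rat_size (r - s) \<le> 2 * (rat_size r + rat_size s)"
  "rat_size (r * s) \<le> 2 * (rat_size r + rat_size s)"
  "rat_size (r / s) \<le> 2 * (rat_size r + rat_size s)"
proof -
  obtain a b where ab: "quotient_of r = (a, b)" by force
  obtain c d where cd: "quotient_of s = (c, d)" by force
  have pos: "b > 0" "d > 0" using ab cd quotient_of_denom_pos by blast+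
  have rs: "r = of_int a / of_int b" "s = of_int c / of_int d"
    using ab cd quotient_of_div by blast+
  define l where "l z = floorlog 2 (nat \<bar>z\<bar>)" for z :: int
  have size: "rat_size r = 1 + l a + l b" "rat_size s = 1 + l c + l d"
    using ab cd pos by (auto simp: rat_size_def l_def)
  have mult: "l (y * z) \<le> l y + l z" for y z
    using floorlog_mult_le[of "nat \<bar>y\<bar>" "nat \<bar>z\<bar>"] by (simp add: l_def abs_mult nat_mult_distrib)
  have add: "l z \<le> Suc (max (l y) (l y'))" if "\<bar>z\<bar> \<le> \<bar>y\<bar> + \<bar>y'\<bar>" for y y' z
  proof -
    have "l z \<le> floorlog 2 (nat \<bar>y\<bar> + nat \<bar>y'\<bar>)"
      unfolding l_def using that by (intro floorlog_mono) simp
    with floorlog_add_le[of "nat \<bar>y\<bar>" "nat \<bar>y'\<bar>"] show ?thesis by (simp add: l_def)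
  qed
  have quot: "rat_size (of_int p / of_int q) \<le> 1 + l p + l q" if "q \<noteq> 0" for p q
    using rat_size_quotient_le[OF that] by (simp add: l_def)
  have "r + s = of_int (a * d + c * b) / of_int (b * d)"
    using pos by (simp add: rs field_simps)
  moreover have "l (a * d + c * b) \<le> Suc (max (l (a * d)) (l (c * b)))" by (rule add) simp
  ultimately show "rat_size (r + s) \<le> 2 * (rat_size r + rat_size s)"
    using quot[of "b * d" "a * d + c * b"] mult[of a d] mult[of c b] mult[of b d] pos
    by (simp add: size)
  have "r - s = of_int (a * d - c * b) / of_int (b * d)"
    using pos by (simp add: rs field_simps)
  moreover have "l (a * d - c * b) \<le> Suc (max (l (a * d)) (l (c * b)))" by (rule add) simp
  ultimately show "rat_size (r - s) \<le> 2 * (rat_size r + rat_size s)"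
    using quot[of "b * d" "a * d - c * b"] mult[of a d] mult[of c b] mult[of b d] pos
    by (simp add: size)
  have "r * s = of_int (a * c) / of_int (b * d)"
    using pos by (simp add: rs field_simps)
  then show "rat_size (r * s) \<le> 2 * (rat_size r + rat_size s)"
    using quot[of "b * d" "a * c"] mult[of a c] mult[of b d] pos by (simp add: size)
  show "rat_size (r / s) \<le> 2 * (rat_size r + rat_size s)"
  proof (cases "c = 0")
    case True
    then show ?thesis using rat_size_pos[of r] by (simp add: rs rat_size_def floorlog_def)
  next
    case False
    have "r / s = of_int (a * d) / of_int (b * c)"
      using pos False by (simp add: rs field_simps)
    then show ?thesis
      using quot[of "b * c" "a * d"] mult[of a d] mult[of b c] pos False by (simp add: size)
  qed
qed

text \<open>Over the denominator \<open>M\<close> the numerator is at most \<open>K * M\<close>. The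
  bound depends on the magnitude and on the denominator alone, not on how many operations produced
  \<open>r\<close>.\<close>

lemma rat_size_le_common_denominator:
  assumes "M > 0" "\<bar>r\<bar> \<le> of_nat K" "r * of_nat M \<in> \<int>"
  shows "rat_size r \<le> 1 + floorlog 2 K + 2 * floorlog 2 M"
proof -
  obtain z where z: "r * of_nat M = of_int z" using assms(3) Ints_cases by blast
  then have r: "r = of_int z / of_int (int M)" using assms(1) by (simp add: field_simps)
  have "of_int \<bar>z\<bar> = \<bar>r\<bar> * of_nat M" using z by (metis abs_mult abs_of_nat of_int_abs)
  also have "\<dots> \<le> of_nat K * of_nat M" using assms by (intro mult_right_mono) auto
  finally have "(of_int \<bar>z\<bar> :: rat) \<le> of_int (int (K * M))" by simp
  then have "nat \<bar>z\<bar> \<le> K * M" by (subst (asm) of_int_le_iff) (simp add: nat_le_iff)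
  then have "floorlog 2 (nat \<bar>z\<bar>) \<le> floorlog 2 K + floorlog 2 M"
    using floorlog_mono floorlog_mult_le order_trans by blast
  then show ?thesis using rat_size_quotient_le[of "int M" z] assms(1) r by simp
qed

section \<open>Programs that fill tables\<close>

definition bounded_store :: "nat \<Rightarrow> store \<Rightarrow> bool" where
  "bounded_store B s \<longleftrightarrow> (\<forall>a i. rat_size (s a i) \<le> B)"

text \<open>An arithmetic operation at most doubles the total size of its operands. Hence a bound on the sizes of
  the cells of the store bounds the cost of an expression up to a factor that depends only on the
  expression.\<close>

fun cost_factor :: "aexp \<Rightarrow> nat" where
  "cost_factor (Const c) = rat_size c"
| "cost_factor (Arr a e) = cost_factor e + 1"
| "cost_factor (Plus e f) = 3 * (cost_factor e + cost_factor f)"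
| "cost_factor (Minus e f) = 3 * (cost_factor e + cost_factor f)"
| "cost_factor (Times e f) = 3 * (cost_factor e + cost_factor f)"
| "cost_factor (Divide e f) = 3 * (cost_factor e + cost_factor f)"

fun bool_cost_factor :: "bexp \<Rightarrow> nat" where
  "bool_cost_factor (Less e f) = cost_factor e + cost_factor f + 1"
| "bool_cost_factor (Neg b) = bool_cost_factor b + 1"
| "bool_cost_factor (Conj b c) = bool_cost_factor b + bool_cost_factor c + 1"

lemma rat_size_le_acost: "rat_size (aval e s) \<le> acost e s"
  by (cases e) auto

text \<open>The factor 3 in \<open>cost_factor\<close> pays once for evaluating the operands and
  twice more for the size of the result, since the sizes of the operands are below their
  costs.\<close>

lemma acost_le:
  assumes "bounded_store B s" "1 \<le> B"
  shows "acost e s \<le> cost_factor e * B"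
proof (induction e)
  case (Const c)
  then show ?case using assms(2) by (cases B) auto
next
  case (Arr a e)
  moreover have "rat_size (s a (nat \<lfloor>aval e s\<rfloor>)) \<le> B" using assms(1) by (simp add: bounded_store_def)
  ultimately show ?case by simp
next
  case (Plus e f)
  then show ?case
    using rat_size_arith_le(1)[of "aval e s" "aval f s"] rat_size_le_acost[of e s] rat_size_le_acost[of f s]
    by (simp add: algebra_simps)
next
  case (Minus e f)
  then show ?case
    using rat_size_arith_le(2)[of "aval e s" "aval f s"] rat_size_le_acost[of e s] rat_size_le_acost[of f s]
    by (simp add: algebra_simps)
next
  case (Times e f)
  then show ?case
    using rat_size_arith_le(3)[of "aval e s" "aval f s"] rat_size_le_acost[of e s] rat_size_le_acost[of f s]
    by (simp add: algebra_simps)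
next
  case (Divide e f)
  then show ?case
    using rat_size_arith_le(4)[of "aval e s" "aval f s"] rat_size_le_acost[of e s] rat_size_le_acost[of f s]
    by (simp add: algebra_simps)
qed

lemma bcost_le:
  assumes "bounded_store B s" "1 \<le> B"
  shows "bcost b s \<le> bool_cost_factor b * B"
proof (induction b)
  case (Less e f)
  then show ?case using acost_le[OF assms, of e] acost_le[OF assms, of f] assms(2)
    by (simp add: algebra_simps)
qed (use assms(2) in \<open>auto simp: algebra_simps\<close>)

text \<open>Arithmetic expressions cannot branch. A \<open>cexp\<close> is a decision tree over
  them, which \<open>store_in\<close> compiles to nested \<open>Cond\<close> commands whose leaves
  assign to the cell at the counter.\<close>

datatype cexp = Val aexp | Ite bexp cexp cexp

fun cval :: "cexp \<Rightarrow> store \<Rightarrow> rat" where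
  "cval (Val e) s = aval e s"
| "cval (Ite b e f) s = (if bval b s then cval e s else cval f s)"

abbreviation counter :: aexp where
  "counter \<equiv> Arr ''c'' (Const 0)"

fun store_in :: "string \<Rightarrow> cexp \<Rightarrow> com" where
  "store_in a (Val e) = Assign a counter e"
| "store_in a (Ite b e f) = Cond b (store_in a e) (store_in a f)"

fun cexp_cost_factor :: "cexp \<Rightarrow> nat" where
  "cexp_cost_factor (Val e) = cost_factor counter + cost_factor e + 1"
| "cexp_cost_factor (Ite b e f) = bool_cost_factor b + cexp_cost_factor e + cexp_cost_factor f"

lemma store_in_step:
  assumes "bounded_store B s" "1 \<le> B"
  shows "\<exists>t. big_step (store_in a e) s t (s(a := (s a)(nat \<lfloor>s ''c'' 0\<rfloor> := cval e s))) \<and>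
             t \<le> cexp_cost_factor e * B"
proof (induction e)
  case (Val e)
  have "big_step (Assign a counter e) s (acost counter s + acost e s + 1)
      (s(a := (s a)(nat \<lfloor>s ''c'' 0\<rfloor> := aval e s)))"
    using big_step.Assign[of a counter e s] by simp
  moreover have "acost counter s + acost e s + 1 \<le> cexp_cost_factor (Val e) * B"
    using acost_le[OF assms, of counter] acost_le[OF assms, of e] assms(2)
    by (simp add: algebra_simps)
  ultimately show ?case by (simp only: store_in.simps cval.simps) blast
next
  case (Ite b e f)
  then obtain t u where
    "big_step (store_in a e) s t (s(a := (s a)(nat \<lfloor>s ''c'' 0\<rfloor> := cval e s)))" "t \<le> cexp_cost_factor e * B"
    "big_step (store_in a f) s u (s(a := (s a)(nat \<lfloor>s ''c'' 0\<rfloor> := cval f s)))" "u \<le> cexp_cost_factor f * B"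
    by blast
  note tu = this
  have "bcost b s + t \<le> cexp_cost_factor (Ite b e f) * B" "bcost b s + u \<le> cexp_cost_factor (Ite b e f) * B"
    using tu bcost_le[OF assms, of b] by (simp_all add: algebra_simps)
  moreover have "big_step (store_in a (Ite b e f)) s (bcost b s + (if bval b s then t else u))
      (s(a := (s a)(nat \<lfloor>s ''c'' 0\<rfloor> := cval (Ite b e f) s)))"
    using tu by (auto intro: CondTrue CondFalse)
  ultimately show ?case by (metis (full_types))
qed

definition fill :: "string \<Rightarrow> aexp \<Rightarrow> cexp \<Rightarrow> com" where
  "fill a N e =
     Seq (Assign ''c'' (Const 0) (Const 0))
         (While (Less counter N) (Seq (store_in a e) (Assign ''c'' (Const 0) (Plus counter (Const 1)))))"

text \<open>This is the store after \<open>m\<close> rounds of the loop when \<open>f\<close> is the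
  intended table; it serves as the loop invariant.\<close>

definition filled :: "store \<Rightarrow> string \<Rightarrow> nat \<Rightarrow> (nat \<Rightarrow> rat) \<Rightarrow> store" where
  "filled s a m f = s(''c'' := (s ''c'')(0 := of_nat m), a := (\<lambda>i. if i < m then f i else s a i))"

text \<open>Chosen so that one multiple of \<open>B\<close> covers a round of the loop, and another
  the initialization together with the last, failing test. The 20 is slack for unit costs.\<close>

definition fill_cost_factor :: "aexp \<Rightarrow> cexp \<Rightarrow> nat" where
  "fill_cost_factor N e = 20 + bool_cost_factor (Less counter N) + cexp_cost_factor e +
     cost_factor (Plus counter (Const 1)) + 2 * rat_size 0"

lemma filled_apply:
  "b \<noteq> a \<Longrightarrow> b \<noteq> ''c'' \<Longrightarrow> filled s a m f b = s b"
  "filled s a m f a i = (if i < m then f i else s a i)"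
  "a \<noteq> ''c'' \<Longrightarrow> filled s a m f ''c'' 0 = of_nat m"
  by (auto simp: filled_def)

lemma bounded_filled:
  assumes "bounded_store B s" "\<And>i. i < m \<Longrightarrow> rat_size (f i) \<le> B" "rat_size (of_nat m) \<le> B"
  shows "bounded_store B (filled s a m f)"
  using assms by (auto simp: bounded_store_def filled_def)

text \<open>The premises on \<open>N\<close> and \<open>e\<close> speak of the partially filled
  store. A cell may thus be computed from earlier cells of the same table, which is what dynamic
  programming requires.\<close>

lemma fill_step:
  assumes bs: "bounded_store B s" and ac: "a \<noteq> ''c''"
    and N: "\<And>m. m \<le> M \<Longrightarrow> aval N (filled s a m f) = of_nat M"
    and e: "\<And>m. m < M \<Longrightarrow> cval e (filled s a m f) = f m"
    and szf: "\<And>m. m < M \<Longrightarrow> rat_size (f m) \<le> B" and szM: "M + 2 \<le> B"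
  shows "\<exists>t. big_step (fill a N e) s t (filled s a M f) \<and> t \<le> fill_cost_factor N e * (M + 1) * B"
proof -
  let ?body = "Seq (store_in a e) (Assign ''c'' (Const 0) (Plus counter (Const 1)))"
  let ?W = "While (Less counter N) ?body"
  let ?K = "fill_cost_factor N e"
  have B: "1 \<le> B" using szM by simp
  have szm: "rat_size (of_nat m) \<le> B" if "m \<le> M" for m
    using rat_size_of_nat_le[of m] that szM by linarith
  have bnd: "bounded_store B (filled s a m f)" if "m \<le> M" for m
    using that by (intro bounded_filled bs szf szm) auto
  \<comment> \<open>Induction downwards from \<open>M\<close>: \<open>M - m\<close> rounds remain,
    and the separate summand pays for the failing test.\<close>
  have loop: "\<exists>t. big_step ?W (filled s a m f) t (filled s a M f) \<and> t \<le> ?K * (M - m) * B + bool_cost_factor (Less counter N) * B"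
    if "m \<le> M" for m
    using that
  proof (induction m rule: inc_induct)
    case base
    have "\<not> bval (Less counter N) (filled s a M f)"
      using N[of M] ac by (simp add: filled_apply)
    from big_step.WhileFalse[OF this, of ?body] show ?case
      using bcost_le[OF bnd[OF order_refl] B, of "Less counter N"]
      by (intro exI[of _ "bcost (Less counter N) (filled s a M f)"]) simp
  next
    case (step m)
    let ?s = "filled s a m f"
    let ?s1 = "?s(a := (?s a)(m := f m))"
    have b: "bval (Less counter N) ?s"
      using N[of m] ac step.hyps by (simp add: filled_apply)
    have bb: "bounded_store B ?s" using bnd step.hyps by simp
    have b1: "bounded_store B ?s1" using bb szf[of m] step.hyps by (auto simp: bounded_store_def)
    obtain t where t: "big_step (store_in a e) ?s t ?s1" "t \<le> cexp_cost_factor e * B"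
      using store_in_step[OF bb B, of a e] e[of m] ac step.hyps by (auto simp: filled_apply)
    have c1: "?s1 ''c'' 0 = of_nat m" using ac by (simp add: filled_apply)
    have "?s1(''c'' := (?s1 ''c'')(0 := aval (Plus counter (Const 1)) ?s1)) = filled s a (Suc m) f"
      using c1 ac by (auto simp: filled_def fun_eq_iff less_Suc_eq)
    then have as: "big_step (Assign ''c'' (Const 0) (Plus counter (Const 1))) ?s1
        (acost (Const 0) ?s1 + acost (Plus counter (Const 1)) ?s1 + 1) (filled s a (Suc m) f)"
      using big_step.Assign[of "''c''" "Const 0" "Plus counter (Const 1)" ?s1] by simp
    obtain u where u: "big_step ?W (filled s a (Suc m) f) u (filled s a M f)"
      "u \<le> ?K * (M - Suc m) * B + bool_cost_factor (Less counter N) * B"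
      using step.IH by blast
    have big: "big_step ?W ?s (bcost (Less counter N) ?s +
        (t + (acost (Const 0) ?s1 + acost (Plus counter (Const 1)) ?s1 + 1)) + u) (filled s a M f)"
      by (rule WhileTrue[OF b Seq[OF t(1) as] u(1)])
    have "bcost (Less counter N) ?s + (t + (acost (Const 0) ?s1 + acost (Plus counter (Const 1)) ?s1 + 1))
      \<le> bool_cost_factor (Less counter N) * B + (cexp_cost_factor e * B + (cost_factor (Const 0) * B +
         cost_factor (Plus counter (Const 1)) * B + 1 * B))"
      using bcost_le[OF bb B, of "Less counter N"] t(2) acost_le[OF b1 B, of "Const 0"]
        acost_le[OF b1 B, of "Plus counter (Const 1)"] B
      by (intro add_mono) auto
    also have "\<dots> \<le> ?K * B"
      unfolding fill_cost_factor_def by (simp only: add_mult_distrib[symmetric] cost_factor.simps(1)) simp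
    finally have "bcost (Less counter N) ?s + (t + (acost (Const 0) ?s1 + acost (Plus counter (Const 1)) ?s1 + 1)) + u
      \<le> ?K * B + (?K * (M - Suc m) * B + bool_cost_factor (Less counter N) * B)"
      using u(2) by (rule add_mono)
    also have "?K * B + (?K * (M - Suc m) * B + bool_cost_factor (Less counter N) * B) =
       ?K * (M - m) * B + bool_cost_factor (Less counter N) * B"
      using step.hyps by (simp add: Suc_diff_Suc[symmetric] algebra_simps)
    finally show ?case using big by blast
  qed
  obtain t where t: "big_step ?W (filled s a 0 f) t (filled s a M f)"
    "t \<le> ?K * M * B + bool_cost_factor (Less counter N) * B"
    using loop[of 0] by auto
  have init: "s(''c'' := (s ''c'')(0 := 0)) = filled s a 0 f"
    using ac by (auto simp: filled_def)
  have "big_step (Assign ''c'' (Const 0) (Const 0)) s (acost (Const 0) s + acost (Const 0) s + 1)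
      (filled s a 0 f)"
    using big_step.Assign[of "''c''" "Const 0" "Const 0" s] by (simp add: init)
  then have "big_step (fill a N e) s ((acost (Const 0) s + acost (Const 0) s + 1) + t) (filled s a M f)"
    unfolding fill_def using t(1) by (rule Seq)
  moreover have "(acost (Const 0) s + acost (Const 0) s + 1) + t \<le> ?K * (M + 1) * B"
  proof -
    have "(acost (Const 0) s + acost (Const 0) s + 1) + t \<le>
      (2 * rat_size 0 + 1) * B + (?K * M * B + bool_cost_factor (Less counter N) * B)"
    proof (rule add_mono[OF _ t(2)])
      have "2 * rat_size 0 + 1 \<le> (2 * rat_size 0 + 1) * B" using B by (cases B) auto
      then show "acost (Const 0) s + acost (Const 0) s + 1 \<le> (2 * rat_size 0 + 1) * B" by simp
    qed
    also have "\<dots> = (2 * rat_size 0 + 1 + bool_cost_factor (Less counter N)) * B + ?K * M * B"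
      by (simp only: add_mult_distrib)
    also have "(2 * rat_size 0 + 1 + bool_cost_factor (Less counter N)) * B \<le> ?K * B"
      unfolding fill_cost_factor_def by (rule mult_le_mono1) simp
    finally show ?thesis by (simp add: algebra_simps)
  qed
  ultimately show ?thesis by blast
qed

section \<open>The rounding program\<close>

abbreviation order_n :: aexp where
  "order_n \<equiv> Arr ''n'' (Const 0)"

fun power_n :: "nat \<Rightarrow> aexp" where
  "power_n 0 = Const 1"
| "power_n (Suc k) = Times order_n (power_n k)"

text \<open>The index of an array access is rounded down, so reading the identity table at a quotient
  performs the integer division that the language lacks.\<close>

definition quo :: "aexp \<Rightarrow> aexp \<Rightarrow> aexp" where
  "quo e f = Arr ''id'' (Divide e f)"

definition remd :: "aexp \<Rightarrow> aexp \<Rightarrow> aexp" where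
  "remd e f = Minus e (Times f (quo e f))"

definition entry :: "string \<Rightarrow> aexp \<Rightarrow> aexp \<Rightarrow> aexp \<Rightarrow> aexp \<Rightarrow> aexp" where
  "entry a q k i j = Arr a (Plus (Times (Plus (Times k q) i) q) j)"

text \<open>The bound \<open>n^4 * (n + 1)\<close> is the size of the \<open>flag\<close> table, the
  largest one, so every index to be decoded can be looked up in \<open>''id''\<close>.\<close>

definition ready :: "nat \<Rightarrow> store \<Rightarrow> bool" where
  "ready n s \<longleftrightarrow> s ''n'' 0 = of_nat n \<and> (\<forall>i < n^4 * (n + 1). s ''id'' i = of_nat i)"

declare power_n.simps [simp del]

lemma aval_nat:
  "aval (Const 0) s = of_nat 0"
  "aval (Const 1) s = of_nat 1"
  "aval e s = of_nat a \<Longrightarrow> aval f s = of_nat b \<Longrightarrow> aval (Plus e f) s = of_nat (a + b)"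
  "aval e s = of_nat a \<Longrightarrow> aval f s = of_nat b \<Longrightarrow> aval (Times e f) s = of_nat (a * b)"
  "aval e s = of_nat a \<Longrightarrow> aval (Arr arr e) s = s arr a"
  by auto

lemma aval_nat_minus:
  "aval e s = of_nat a \<Longrightarrow> aval f s = of_nat b \<Longrightarrow> b \<le> a \<Longrightarrow> aval (Minus e f) s = of_nat (a - b)"
  by (simp add: of_nat_diff)

lemma aval_power_n: "s ''n'' 0 = of_nat n \<Longrightarrow> aval (power_n k) s = of_nat (n ^ k)"
  by (induction k) (auto simp: power_n.simps)

lemma aval_quo:
  assumes "ready n s" "aval e s = of_nat a" "aval f s = of_nat b" "a < n^4 * (n + 1)"
  shows "aval (quo e f) s = of_nat (a div b)"
proof -
  have "a div b < n^4 * (n + 1)" using assms(4) div_le_dividend le_less_trans by blast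
  then show ?thesis
    using assms by (simp add: quo_def ready_def floor_divide_of_nat_eq)
qed

lemma aval_remd:
  assumes "ready n s" "aval e s = of_nat a" "aval f s = of_nat b" "a < n^4 * (n + 1)"
  shows "aval (remd e f) s = of_nat (a mod b)"
proof -
  have "aval (remd e f) s = of_nat (a - b * (a div b))"
    unfolding remd_def by (intro aval_nat_minus aval_nat aval_quo[OF assms]) (use assms in simp_all)
  then show ?thesis by (simp add: minus_mult_div_eq_mod)
qed

lemma aval_entry:
  assumes "aval q s = of_nat q'" "aval k s = of_nat k'" "aval i s = of_nat i'" "aval j s = of_nat j'"
  shows "aval (entry a q k i j) s = s a ((k' * q' + i') * q' + j')"
  unfolding entry_def by (intro aval_nat assms)

lemma index3_decode:
  fixes q :: nat
  assumes "i < q" "j < q"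
  shows "((k * q + i) * q + j) div q^2 = k" "((k * q + i) * q + j) div q mod q = i"
    "((k * q + i) * q + j) mod q = j"
proof -
  have *: "((k * q + i) * q + j) div q = k * q + i" using assms by simp
  then show "((k * q + i) * q + j) div q mod q = i" using assms by simp
  have "((k * q + i) * q + j) div q^2 = ((k * q + i) * q + j) div q div q"
    by (simp only: power2_eq_square div_mult2_eq)
  with * show "((k * q + i) * q + j) div q^2 = k" using assms by simp
  show "((k * q + i) * q + j) mod q = j" using assms by simp
qed

lemma index3_less:
  fixes q :: nat
  assumes "i < q" "j < q"
  shows "(k * q + i) * q + j < (k + 1) * q^2"
proof -
  have "(k * q + i) * q + j < (k * q + i + 1) * q" using assms by simp
  also have "\<dots> \<le> ((k + 1) * q) * q" using assms by (intro mult_le_mono1) simp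
  finally show ?thesis by (simp add: power2_eq_square algebra_simps)
qed

text \<open>Since \<open>layer_index\<close> and its companions decode the cell one layer back, the
  cell being filled has the same row and column and the successor layer.\<close>

lemma index3_shift:
  fixes q :: nat
  assumes "q > 0"
  shows "(q^2 + m) div q^2 = Suc (m div q^2)" "(q^2 + m) div q mod q = m div q mod q"
    "(q^2 + m) mod q = m mod q"
proof -
  show "(q^2 + m) div q^2 = Suc (m div q^2)" using assms by simp
  have "(q^2 + m) div q = q + m div q" using assms by (simp add: power2_eq_square)
  then show "(q^2 + m) div q mod q = m div q mod q" by simp
  show "(q^2 + m) mod q = m mod q" by (simp add: power2_eq_square)
qed

abbreviation shifted :: "nat \<Rightarrow> aexp" where
  "shifted k \<equiv> Minus counter (power_n k)"

text \<open>Tables with three indices \<open>k \<le> q\<close>, \<open>i < q\<close>, \<open>j < q\<close> are stored at \<open>(k * q + i) * q + j\<close>, and layer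
  \<open>k + 1\<close> is computed from layer \<open>k\<close>. The expressions below decode the indices of the cell one layer back,
  at \<open>counter - q\<^sup>2\<close>.\<close>

abbreviation layer_index :: "nat \<Rightarrow> aexp" where "layer_index k \<equiv> quo (shifted k) (power_n k)"
abbreviation row_index :: "nat \<Rightarrow> aexp \<Rightarrow> aexp" where "row_index k q \<equiv> remd (quo (shifted k) q) q"
abbreviation column_index :: "nat \<Rightarrow> aexp \<Rightarrow> aexp" where "column_index k q \<equiv> remd (shifted k) q"

lemma aval_layer_indices:
  assumes r: "ready n s" and c: "s ''c'' 0 = of_nat (n^k + m)" and m: "m < n^4 * (n + 1)"
    and q: "aval q s = of_nat q'"
  shows "aval (shifted k) s = of_nat m" "aval (layer_index k) s = of_nat (m div n^k)"
    "aval (row_index k q) s = of_nat (m div q' mod q')" "aval (column_index k q) s = of_nat (m mod q')"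
proof -
  have pn: "aval (power_n k) s = of_nat (n^k)" for k
    using r by (intro aval_power_n) (simp add: ready_def)
  have "aval counter s = of_nat (n^k + m)" using c by simp
  from aval_nat_minus[OF this pn[of k]] show sh: "aval (shifted k) s = of_nat m" by simp
  show "aval (layer_index k) s = of_nat (m div n^k)" by (rule aval_quo[OF r sh pn m])
  show "aval (column_index k q) s = of_nat (m mod q')" by (rule aval_remd[OF r sh q m])
  have "m div q' < n^4 * (n + 1)" using m div_le_dividend le_less_trans by blast
  then show "aval (row_index k q) s = of_nat (m div q' mod q')"
    by (intro aval_remd[OF r _ q] aval_quo[OF r sh q m])
qed

text \<open>Layer 0 holds the arc lengths; the two negated comparisons test for the diagonal, as
  \<open>Less\<close> is the only comparison. The later layers are the rounds of
  Floyd-Warshall.\<close>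

definition distance_cexp :: cexp where
  "distance_cexp =
     Ite (Less counter (power_n 2))
       (Ite (Conj (Neg (Less (quo counter order_n) (remd counter order_n)))
                  (Neg (Less (remd counter order_n) (quo counter order_n))))
          (Val (Const 0))
          (Ite (Conj (Less (Const 0) (Arr ''E'' counter)) (Less (Arr ''x'' counter) (Const 1)))
             (Val (Arr ''x'' counter))
             (Val (Const 1))))
       (let via = Plus (entry ''d'' order_n (layer_index 2) (row_index 2 order_n) (layer_index 2))
                       (entry ''d'' order_n (layer_index 2) (layer_index 2) (column_index 2 order_n));
            old = Arr ''d'' (shifted 2)
        in Ite (Less via old) (Val via) (Val old))"

text \<open>Layer \<open>k\<close> accounts for the sources below \<open>k\<close>, and the default
  1 is the cap of the distance. The entry \<open>new\<close> comes from layer \<open>n\<close> of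
  \<open>''d''\<close>, the final distances.\<close>

definition nearest_cexp :: cexp where
  "nearest_cexp =
     Ite (Less counter (power_n 2))
       (Val (Const 1))
       (let new = entry ''d'' order_n order_n (layer_index 2) (column_index 2 order_n); old = Arr ''D'' (shifted 2)
        in Ite (Conj (Less (Const 0) (entry ''F'' order_n (Const 0) (layer_index 2) (row_index 2 order_n))) (Less new old))
             (Val new) (Val old))"

text \<open>The indices are the number of sinks examined, a candidate radius and an arc. The last
  two range over \<open>n^2\<close> vertex pairs, so a layer has \<open>n^4\<close> cells. The
  offset \<open>power_n 3\<close> leads to the final layer of \<open>''d''\<close>, where the
  candidate radii are stored.\<close>

definition flag_cexp :: cexp where
  "flag_cexp =
     Ite (Less counter (power_n 4))
       (Val (Const 0))
       (let radius = Arr ''d'' (Plus (power_n 3) (row_index 4 (power_n 2)));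
            tail_dist = entry ''D'' order_n order_n (layer_index 4) (quo (column_index 4 (power_n 2)) order_n);
            head_dist = entry ''D'' order_n order_n (layer_index 4) (remd (column_index 4 (power_n 2)) order_n)
        in Ite (Conj (Neg (Less radius tail_dist)) (Less radius head_dist))
             (Val (Const 1)) (Val (Arr ''flag'' (shifted 4))))"

text \<open>Partial sums over the arcs, for all radii in parallel. The input stores weight 0 for
  non-arcs, so their flags do not disturb the sum.\<close>

definition weight_cexp :: cexp where
  "weight_cexp =
     Ite (Less counter (power_n 2))
       (Val (Const 0))
       (let e = quo (shifted 2) (power_n 2); p = remd (shifted 2) (power_n 2)
        in Val (Plus (Arr ''W'' (shifted 2)) (Times (Arr ''w'' e) (entry ''flag'' (power_n 2) order_n p e))))"

text \<open>A running argmin over the radii below 1, for which the cut is feasible. The initial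
  index 0 denotes vertex 0 paired with itself, whose distance 0 is an admissible radius. The offset
  \<open>power_n 4\<close> leads to the final layer of \<open>''W''\<close>.\<close>

definition best_cexp :: cexp where
  "best_cexp =
     Ite (Less counter (Const 1))
       (Val (Const 0))
       (let p = Minus counter (Const 1); old = Arr ''best'' p
        in Ite (Conj (Less (Arr ''d'' (Plus (power_n 3) p)) (Const 1))
                     (Less (Arr ''W'' (Plus (power_n 4) p)) (Arr ''W'' (Plus (power_n 4) old))))
             (Val p) (Val old))"

text \<open>Flags are computed for all vertex pairs; the factor from \<open>''E''\<close> restricts
  them to arcs.\<close>

definition cut_cexp :: cexp where
  "cut_cexp = Val (Times (Arr ''E'' counter)
     (entry ''flag'' (power_n 2) order_n (Arr ''best'' (power_n 2)) counter))"

section \<open>The recursive functions behind the tables\<close>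

fun floyd_warshall :: "(nat \<Rightarrow> nat \<Rightarrow> 'b::linordered_idom) \<Rightarrow> nat \<Rightarrow> nat \<Rightarrow> nat \<Rightarrow> 'b" where
  "floyd_warshall d 0 i j = d i j"
| "floyd_warshall d (Suc k) i j =
     min (floyd_warshall d k i j) (floyd_warshall d k i k + floyd_warshall d k k j)"

fun nearest :: "(nat \<Rightarrow> nat \<Rightarrow> bool) \<Rightarrow> (nat \<Rightarrow> nat \<Rightarrow> 'b::linordered_idom) \<Rightarrow> nat \<Rightarrow> nat \<Rightarrow> nat \<Rightarrow> 'b" where
  "nearest F d 0 t v = 1"
| "nearest F d (Suc s) t v =
     (if F s t \<and> d s v < nearest F d s t v then d s v else nearest F d s t v)"

text \<open>The input appears as raw arrays: the agreement of cell expressions with recursive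
  functions is a matter of indices, kept apart from their meaning for the graph.\<close>

locale rounding_tables =
  fixes n :: nat and E F w x :: "nat \<Rightarrow> rat"
begin

definition arc_length :: "nat \<Rightarrow> nat \<Rightarrow> rat" where
  "arc_length i j = (if i = j then 0 else if 0 < E (i * n + j) \<and> x (i * n + j) < 1 then x (i * n + j) else 1)"

definition dist_step :: "nat \<Rightarrow> nat \<Rightarrow> nat \<Rightarrow> rat" where
  "dist_step = floyd_warshall arc_length"

definition dist :: "nat \<Rightarrow> nat \<Rightarrow> rat" where
  "dist = dist_step n"

definition near_step :: "nat \<Rightarrow> nat \<Rightarrow> nat \<Rightarrow> rat" where
  "near_step = nearest (\<lambda>s t. 0 < F (s * n + t)) dist"

definition radius :: "nat \<Rightarrow> rat" where
  "radius p = dist (p div n) (p mod n)"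

fun flag :: "nat \<Rightarrow> nat \<Rightarrow> nat \<Rightarrow> rat" where
  "flag 0 p e = 0"
| "flag (Suc t) p e =
     (if near_step n t (e div n) \<le> radius p \<and> radius p < near_step n t (e mod n) then 1 else flag t p e)"

definition weight :: "nat \<Rightarrow> nat \<Rightarrow> rat" where
  "weight m p = (\<Sum>e<m. w e * flag n p e)"

fun best :: "nat \<Rightarrow> nat" where
  "best 0 = 0"
| "best (Suc p) =
     (if radius p < 1 \<and> weight (n^2) p < weight (n^2) (best p) then p else best p)"

definition dist_table :: "nat \<Rightarrow> rat" where
  "dist_table m = dist_step (m div n^2) (m div n mod n) (m mod n)"

definition near_table :: "nat \<Rightarrow> rat" where
  "near_table m = near_step (m div n^2) (m div n mod n) (m mod n)"

definition flag_table :: "nat \<Rightarrow> rat" where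
  "flag_table m = flag (m div n^4) (m div n^2 mod n^2) (m mod n^2)"

definition weight_table :: "nat \<Rightarrow> rat" where
  "weight_table m = weight (m div n^2) (m mod n^2)"

lemma dist_table_entry: "i < n \<Longrightarrow> j < n \<Longrightarrow> dist_table ((k * n + i) * n + j) = dist_step k i j"
  by (simp add: dist_table_def index3_decode)

lemma near_table_entry: "i < n \<Longrightarrow> j < n \<Longrightarrow> near_table ((k * n + i) * n + j) = near_step k i j"
  by (simp add: near_table_def index3_decode)

lemma flag_table_entry:
  "p < n^2 \<Longrightarrow> e < n^2 \<Longrightarrow> flag_table ((k * n^2 + p) * n^2 + e) = flag k p e"
  using index3_decode[of p "n^2" e k] by (simp add: flag_table_def)

lemma weight_table_entry: "p < n^2 \<Longrightarrow> weight_table (n^4 + p) = weight (n^2) p"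
proof -
  assume "p < n^2"
  moreover have "n^4 + p = n^2 * n^2 + p" by (simp flip: power_add)
  moreover have "(q * q + p) div q = q \<and> (q * q + p) mod q = p" if "p < q" for q :: nat
    using that by simp
  ultimately show ?thesis unfolding weight_table_def by metis
qed

lemma radius_entry: "p < n^2 \<Longrightarrow> dist_table (n^3 + p) = radius p"
proof -
  assume p: "p < n^2"
  then have n: "n > 0" by (cases n) auto
  then have "p mod n < n" "p div n < n" using p by (auto simp: power2_eq_square less_mult_imp_div_less)
  moreover have "n^3 + p = (n * n + p div n) * n + p mod n"
    by (simp add: power3_eq_cube algebra_simps)
  ultimately show ?thesis by (simp only: dist_table_entry) (simp add: radius_def dist_def)
qed

lemma cval_distance:
  assumes r: "ready n s" and c: "s ''c'' 0 = of_nat m" and m: "m < n^2 * (n + 1)"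
    and arr: "s ''E'' = E" "s ''x'' = x" and d: "\<And>i. i < m \<Longrightarrow> s ''d'' i = dist_table i"
  shows "cval distance_cexp s = dist_table m"
proof -
  have n: "n > 0" using m by (cases n) auto
  have pn: "aval (power_n k) s = of_nat (n^k)" for k
    using r by (intro aval_power_n) (simp add: ready_def)
  have on: "aval order_n s = of_nat n" using r by (simp add: ready_def)
  have cnt: "aval counter s = of_nat m" using c by simp
  have big: "n^2 * (n + 1) \<le> n^4 * (n + 1)" using n by (intro mult_le_mono1 power_increasing) auto
  then have m4: "m < n^4 * (n + 1)" using m by linarith
  show ?thesis
  proof (cases "m < n^2")
    case True
    have ij: "aval (quo counter order_n) s = of_nat (m div n)" "aval (remd counter order_n) s = of_nat (m mod n)"
      by (rule aval_quo[OF r cnt on m4] aval_remd[OF r cnt on m4])+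
    have "m div n < n" using True by (simp add: less_mult_imp_div_less power2_eq_square)
    then have "dist_table m = arc_length (m div n) (m mod n)"
      using True by (simp add: dist_table_def dist_step_def)
    moreover have "m div n * n + m mod n = m" by simp
    moreover have "aval (Arr ''E'' counter) s = E m" "aval (Arr ''x'' counter) s = x m"
      using aval_nat(5)[OF cnt, of "''E''"] aval_nat(5)[OF cnt, of "''x''"] arr by simp_all
    moreover have "bval (Less counter (power_n 2)) s"
      using True by (simp only: bval.simps cnt pn of_nat_less_iff)
    ultimately show ?thesis
      unfolding distance_cexp_def arc_length_def cval.simps bval.simps ij of_nat_less_iff aval.simps(1)
      by (simp only: if_True) (auto simp: linorder_neq_iff)
  next
    case False
    define m' where "m' = m - n^2"
    have mm: "m = n^2 + m'" using False by (simp add: m'_def)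
    have m3: "m' < n^2 * n" using m mm by (simp add: algebra_simps)
    let ?k = "m' div n^2" and ?i = "m' div n mod n" and ?j = "m' mod n"
    have "m' < n^4 * (n + 1)" using m4 mm by simp
    note ind = aval_layer_indices[OF r c[unfolded mm] this on]
    have k: "?k < n" using m3 by (simp add: less_mult_imp_div_less mult.commute)
    have ij: "?i < n" "?j < n" using n by auto
    \<comment> \<open>All reads fall into layer \<open>?k\<close>, which is complete before cell
      \<open>m\<close> is filled.\<close>
    have less: "(?k * n + a) * n + b < m" if "a < n" "b < n" for a b
    proof -
      have "(?k * n + a) * n + b < (?k + 1) * n^2" using that by (rule index3_less)
      also have "\<dots> = n^2 + n^2 * ?k" by (simp add: algebra_simps)
      also have "\<dots> \<le> m" using mm by simp
      finally show ?thesis .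
    qed
    have via: "aval (entry ''d'' order_n (layer_index 2) (row_index 2 order_n) (layer_index 2)) s = dist_step ?k ?i ?k"
      "aval (entry ''d'' order_n (layer_index 2) (layer_index 2) (column_index 2 order_n)) s = dist_step ?k ?k ?j"
      using aval_entry[OF on ind(2,3,2), of "''d''"] aval_entry[OF on ind(2,2,4), of "''d''"] d less k ij
      by (simp_all only: dist_table_entry)
    have "m' < m" using mm n by simp
    then have old: "aval (Arr ''d'' (shifted 2)) s = dist_step ?k ?i ?j"
      using aval_nat(5)[OF ind(1), of "''d''"] d by (simp only: dist_table_def)
    have "dist_table m = dist_step (Suc ?k) ?i ?j"
      using n by (simp only: dist_table_def mm index3_shift)
    moreover have "\<not> bval (Less counter (power_n 2)) s"
      using False by (simp only: bval.simps cnt pn of_nat_less_iff not_False_eq_True)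
    ultimately show ?thesis
      unfolding distance_cexp_def Let_def cval.simps bval.simps(1) aval.simps(3) via old
      by (auto simp: dist_step_def min_def)
  qed
qed

lemma cval_nearest:
  assumes r: "ready n s" and c: "s ''c'' 0 = of_nat m" and m: "m < n^2 * (n + 1)"
    and F: "s ''F'' = F" and d: "\<And>i. i < n^2 * (n + 1) \<Longrightarrow> s ''d'' i = dist_table i"
    and D: "\<And>i. i < m \<Longrightarrow> s ''D'' i = near_table i"
  shows "cval nearest_cexp s = near_table m"
proof -
  have n: "n > 0" using m by (cases n) auto
  have pn: "aval (power_n k) s = of_nat (n^k)" for k
    using r by (intro aval_power_n) (simp add: ready_def)
  have on: "aval order_n s = of_nat n" using r by (simp add: ready_def)
  have cnt: "aval counter s = of_nat m" using c by simp
  have big: "n^2 * (n + 1) \<le> n^4 * (n + 1)" using n by (intro mult_le_mono1 power_increasing) auto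
  then have m4: "m < n^4 * (n + 1)" using m by linarith
  show ?thesis
  proof (cases "m < n^2")
    case True
    then have "near_table m = 1" by (simp add: near_table_def near_step_def)
    moreover have "bval (Less counter (power_n 2)) s"
      using True by (simp only: bval.simps cnt pn of_nat_less_iff)
    ultimately show ?thesis by (simp add: nearest_cexp_def)
  next
    case False
    define m' where "m' = m - n^2"
    have mm: "m = n^2 + m'" using False by (simp add: m'_def)
    have m3: "m' < n^2 * n" using m mm by (simp add: algebra_simps)
    let ?k = "m' div n^2" and ?i = "m' div n mod n" and ?j = "m' mod n"
    have "m' < n^4 * (n + 1)" using m4 mm by simp
    note ind = aval_layer_indices[OF r c[unfolded mm] this on]
    have k: "?k < n" using m3 by (simp add: less_mult_imp_div_less mult.commute)
    have ij: "?i < n" "?j < n" using n by auto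
    have "(n * n + ?k) * n + ?j < (n + 1) * n^2" using k ij by (intro index3_less)
    then have new: "aval (entry ''d'' order_n order_n (layer_index 2) (column_index 2 order_n)) s = dist ?k ?j"
      using aval_entry[OF on on ind(2,4), of "''d''"] d k ij
      by (simp only: dist_table_entry mult.commute[of "n^2"] dist_def)
    have F': "aval (entry ''F'' order_n (Const 0) (layer_index 2) (row_index 2 order_n)) s = F (?k * n + ?i)"
      using aval_entry[OF on aval_nat(1) ind(2,3), of "''F''"] F by simp
    have "m' < m" using mm n by simp
    then have old: "aval (Arr ''D'' (shifted 2)) s = near_step ?k ?i ?j"
      using aval_nat(5)[OF ind(1), of "''D''"] D by (simp only: near_table_def)
    have "near_table m = near_step (Suc ?k) ?i ?j"
      using n by (simp only: near_table_def mm index3_shift)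
    moreover have "\<not> bval (Less counter (power_n 2)) s"
      using False by (simp only: bval.simps cnt pn of_nat_less_iff not_False_eq_True)
    ultimately show ?thesis
      unfolding nearest_cexp_def Let_def cval.simps bval.simps(1,3) new old F' aval.simps(1)
      by (auto simp: near_step_def)
  qed
qed

lemma cval_flag:
  assumes r: "ready n s" and c: "s ''c'' 0 = of_nat m" and m: "m < n^4 * (n + 1)"
    and d: "\<And>i. i < n^2 * (n + 1) \<Longrightarrow> s ''d'' i = dist_table i"
    and D: "\<And>i. i < n^2 * (n + 1) \<Longrightarrow> s ''D'' i = near_table i"
    and fl: "\<And>i. i < m \<Longrightarrow> s ''flag'' i = flag_table i"
  shows "cval flag_cexp s = flag_table m"
proof -
  have n: "n > 0" using m by (cases n) auto
  have pn: "aval (power_n k) s = of_nat (n^k)" for k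
    using r by (intro aval_power_n) (simp add: ready_def)
  have on: "aval order_n s = of_nat n" using r by (simp add: ready_def)
  have cnt: "aval counter s = of_nat m" using c by simp
  show ?thesis
  proof (cases "m < n^4")
    case True
    then have "flag_table m = 0" by (simp add: flag_table_def)
    moreover have "bval (Less counter (power_n 4)) s"
      using True by (simp only: bval.simps cnt pn of_nat_less_iff)
    ultimately show ?thesis by (simp add: flag_cexp_def)
  next
    case False
    define m' where "m' = m - n^4"
    have mm: "m = n^4 + m'" using False by (simp add: m'_def)
    have m3: "m' < n^4 * n" using m mm by (simp add: algebra_simps)
    let ?t = "m' div n^4" and ?p = "m' div n^2 mod n^2" and ?e = "m' mod n^2"
    have m'4: "m' < n^4 * (n + 1)" using m mm by simp
    note ind = aval_layer_indices[OF r c[unfolded mm] m'4 pn[of 2]]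
    have t: "?t < n" using m3 by (simp add: less_mult_imp_div_less mult.commute)
    have pe: "?p < n^2" "?e < n^2" using n by auto
    have e4: "?e < n^4 * (n + 1)" using m'4 mod_less_eq_dividend le_less_trans by blast
    have e: "?e div n < n" "?e mod n < n"
      using pe(2) n by (auto simp: less_mult_imp_div_less power2_eq_square)
    have "n^3 + ?p < n^2 * (n + 1)" using pe by (simp add: power3_eq_cube power2_eq_square)
    then have rad: "aval (Arr ''d'' (Plus (power_n 3) (row_index 4 (power_n 2)))) s = radius ?p"
      using aval_nat(5)[OF aval_nat(3)[OF pn[of 3] ind(3)], of "''d''"] d pe by (simp only: radius_entry)
    have le: "(n * n + ?t) * n + b < n^2 * (n + 1)" if "b < n" for b
      using index3_less[OF t that, of n] by (simp only: mult.commute)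
    have tl: "aval (entry ''D'' order_n order_n (layer_index 4) (quo (column_index 4 (power_n 2)) order_n)) s
        = near_step n ?t (?e div n)"
      using aval_entry[OF on on ind(2) aval_quo[OF r ind(4) on e4], of "''D''"] D[OF le[OF e(1)]] t e(1)
      by (simp only: near_table_entry)
    have hd: "aval (entry ''D'' order_n order_n (layer_index 4) (remd (column_index 4 (power_n 2)) order_n)) s
        = near_step n ?t (?e mod n)"
      using aval_entry[OF on on ind(2) aval_remd[OF r ind(4) on e4], of "''D''"] D[OF le[OF e(2)]] t e(2)
      by (simp only: near_table_entry)
    have "m' < m" using mm n by simp
    then have old: "aval (Arr ''flag'' (shifted 4)) s = flag ?t ?p ?e"
      using aval_nat(5)[OF ind(1), of "''flag''"] fl by (simp only: flag_table_def)
    have "flag_table m = flag (Suc ?t) ?p ?e"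
      using n index3_shift[of "n^2" m'] by (simp add: flag_table_def mm)
    moreover have "\<not> bval (Less counter (power_n 4)) s"
      using False by (simp only: bval.simps cnt pn of_nat_less_iff not_False_eq_True)
    ultimately show ?thesis
      unfolding flag_cexp_def Let_def cval.simps bval.simps(1,2,3) rad tl hd old aval.simps(1)
      by (auto simp: not_less)
  qed
qed

lemma cval_weight:
  assumes r: "ready n s" and c: "s ''c'' 0 = of_nat m" and m: "m < n^2 * (n^2 + 1)"
    and w: "s ''w'' = w"
    and fl: "\<And>i. i < n^4 * (n + 1) \<Longrightarrow> s ''flag'' i = flag_table i"
    and W: "\<And>i. i < m \<Longrightarrow> s ''W'' i = weight_table i"
  shows "cval weight_cexp s = weight_table m"
proof -
  have n: "n > 0" using m by (cases n) auto
  have pn: "aval (power_n k) s = of_nat (n^k)" for k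
    using r by (intro aval_power_n) (simp add: ready_def)
  have on: "aval order_n s = of_nat n" using r by (simp add: ready_def)
  have cnt: "aval counter s = of_nat m" using c by simp
  \<comment> \<open>The indices of this table must lie inside the identity table for
    \<open>quo\<close> to be integer division.\<close>
  have "n^2 * (n^2 + 1) \<le> n^4 * (n + 1)"
  proof -
    have "n^2 * (n^2 + 1) = n^4 + n^2" by (simp add: algebra_simps flip: power_add)
    also have "\<dots> \<le> n^4 + n^5" using n by (intro add_left_mono power_increasing) auto
    finally show ?thesis by (simp add: algebra_simps flip: power_Suc)
  qed
  then have m4: "m < n^4 * (n + 1)" using m by linarith
  show ?thesis
  proof (cases "m < n^2")
    case True
    then have "weight_table m = 0" by (simp add: weight_table_def weight_def)
    moreover have "bval (Less counter (power_n 2)) s"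
      using True by (simp only: bval.simps cnt pn of_nat_less_iff)
    ultimately show ?thesis by (simp add: weight_cexp_def)
  next
    case False
    define m' where "m' = m - n^2"
    have mm: "m = n^2 + m'" using False by (simp add: m'_def)
    have m3: "m' < n^2 * n^2" using m mm by (simp add: algebra_simps)
    let ?e = "m' div n^2" and ?p = "m' mod n^2"
    have "m' < n^4 * (n + 1)" using m4 mm by simp
    note ind = aval_layer_indices[OF r c[unfolded mm] this pn[of 2]]
    have ep: "?e < n^2" "?p < n^2" using m3 n by (auto simp: less_mult_imp_div_less)
    have "(n * n^2 + ?p) * n^2 + ?e < (n + 1) * (n^2)^2" using ep by (intro index3_less)
    then have "(n * n^2 + ?p) * n^2 + ?e < n^4 * (n + 1)" by (simp add: algebra_simps)
    then have f: "aval (entry ''flag'' (power_n 2) order_n (column_index 2 (power_n 2)) (layer_index 2)) s = flag n ?p ?e"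
      using aval_entry[OF pn on ind(4,2), of "''flag''"] fl ep by (simp only: flag_table_entry)
    have "m' < m" using mm n by simp
    then have old: "aval (Arr ''W'' (shifted 2)) s = weight ?e ?p"
      using aval_nat(5)[OF ind(1), of "''W''"] W by (simp only: weight_table_def)
    have w': "aval (Arr ''w'' (layer_index 2)) s = w ?e"
      using aval_nat(5)[OF ind(2), of "''w''"] w by simp
    have "weight_table m = weight (Suc ?e) ?p"
      using n by (simp add: weight_table_def mm)
    moreover have "\<not> bval (Less counter (power_n 2)) s"
      using False by (simp only: bval.simps cnt pn of_nat_less_iff not_False_eq_True)
    ultimately show ?thesis
      unfolding weight_cexp_def Let_def cval.simps aval.simps(3,5) f old w' by (simp add: weight_def)
  qed
qed

lemma best_less: "n > 0 \<Longrightarrow> p \<le> n^2 \<Longrightarrow> best p < n^2"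
  by (induction p) auto

lemma cval_best:
  assumes r: "ready n s" and c: "s ''c'' 0 = of_nat m" and m: "m < n^2 + 1"
    and d: "\<And>i. i < n^2 * (n + 1) \<Longrightarrow> s ''d'' i = dist_table i"
    and W: "\<And>i. i < n^2 * (n^2 + 1) \<Longrightarrow> s ''W'' i = weight_table i"
    and best: "\<And>i. i < m \<Longrightarrow> s ''best'' i = of_nat (best i)"
  shows "cval best_cexp s = of_nat (best m)"
proof (cases m)
  case 0
  then show ?thesis using c by (simp add: best_cexp_def)
next
  case (Suc p)
  then have p: "p < n^2" using m by simp
  then have n: "n > 0" by (cases n) auto
  have pn: "aval (power_n k) s = of_nat (n^k)" for k
    using r by (intro aval_power_n) (simp add: ready_def)
  have cnt: "aval counter s = of_nat m" using c by simp
  have p': "aval (Minus counter (Const 1)) s = of_nat p"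
    using aval_nat_minus[OF cnt aval_nat(2)] Suc by simp
  have b: "aval (Arr ''best'' (Minus counter (Const 1))) s = of_nat (best p)"
    using aval_nat(5)[OF p', of "''best''"] best Suc by simp
  have bp: "best p < n^2" using best_less[OF n] p by simp
  have "n^3 + p < n^2 * (n + 1)" using p by (simp add: power3_eq_cube power2_eq_square)
  then have rad: "aval (Arr ''d'' (Plus (power_n 3) (Minus counter (Const 1)))) s = radius p"
    using aval_nat(5)[OF aval_nat(3)[OF pn[of 3] p'], of "''d''"] d p by (simp only: radius_entry)
  have n4: "n^4 + i < n^2 * (n^2 + 1)" if "i < n^2" for i
  proof -
    have "n^4 = n^2 * n^2" by (simp flip: power_add)
    with that show ?thesis by simp
  qed
  have W1: "aval (Arr ''W'' (Plus (power_n 4) (Minus counter (Const 1)))) s = weight (n^2) p"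
    using aval_nat(5)[OF aval_nat(3)[OF pn[of 4] p'], of "''W''"] W[OF n4[OF p]] p
    by (simp only: weight_table_entry)
  have W2: "aval (Arr ''W'' (Plus (power_n 4) (Arr ''best'' (Minus counter (Const 1))))) s = weight (n^2) (best p)"
    using aval_nat(5)[OF aval_nat(3)[OF pn[of 4] b], of "''W''"] W[OF n4[OF bp]] bp
    by (simp only: weight_table_entry)
  have "\<not> bval (Less counter (Const 1)) s" using c Suc by simp
  then show ?thesis
    unfolding best_cexp_def Let_def cval.simps bval.simps(1,3) rad W1 W2 b p' aval.simps(1)
    by (simp add: Suc)
qed

lemma cval_cut:
  assumes r: "ready n s" and c: "s ''c'' 0 = of_nat m" and m: "m < n^2"
    and E: "s ''E'' = E"
    and fl: "\<And>i. i < n^4 * (n + 1) \<Longrightarrow> s ''flag'' i = flag_table i"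
    and best: "\<And>i. i < n^2 + 1 \<Longrightarrow> s ''best'' i = of_nat (best i)"
  shows "cval cut_cexp s = E m * flag n (best (n^2)) m"
proof -
  have n: "n > 0" using m by (cases n) auto
  have pn: "aval (power_n k) s = of_nat (n^k)" for k
    using r by (intro aval_power_n) (simp add: ready_def)
  have on: "aval order_n s = of_nat n" using r by (simp add: ready_def)
  have cnt: "aval counter s = of_nat m" using c by simp
  have b: "aval (Arr ''best'' (power_n 2)) s = of_nat (best (n^2))"
    using aval_nat(5)[OF pn[of 2], of "''best''"] best[of "n^2"] by simp
  have bp: "best (n^2) < n^2" using best_less[OF n] by simp
  have "(n * n^2 + best (n^2)) * n^2 + m < (n + 1) * (n^2)^2" using bp m by (intro index3_less)
  then have "(n * n^2 + best (n^2)) * n^2 + m < n^4 * (n + 1)" by (simp add: algebra_simps)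
  then have f: "aval (entry ''flag'' (power_n 2) order_n (Arr ''best'' (power_n 2)) counter) s = flag n (best (n^2)) m"
    using aval_entry[OF pn on b cnt, of "''flag''"] fl bp m by (simp only: flag_table_entry)
  have "aval (Arr ''E'' counter) s = E m" using aval_nat(5)[OF cnt, of "''E''"] E by simp
  then show ?thesis unfolding cut_cexp_def cval.simps aval.simps(5) f by simp
qed

end

section \<open>Correctness of the rounding program\<close>

lemma floyd_warshall_nonneg:
  assumes "\<And>i j. 0 \<le> d i j"
  shows "0 \<le> floyd_warshall d k i j"
  using assms by (induction k arbitrary: i j) auto

lemma floyd_warshall_le: "floyd_warshall d k i j \<le> d i j"
  by (induction k) (auto simp: min.coboundedI1)

lemma floyd_warshall_self:
  assumes "\<And>i j. 0 \<le> d i j" "\<And>i. d i i = 0"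
  shows "floyd_warshall d k i i = 0"
  using floyd_warshall_le[of d k i i] floyd_warshall_nonneg[of d k i i] assms by force

text \<open>The round that processes \<open>m\<close> establishes the inequality through
  \<open>m\<close>, and the later rounds preserve it.\<close>

lemma floyd_warshall_triangle:
  assumes nn: "\<And>i j. 0 \<le> d i j" and self: "\<And>i. d i i = 0" and "m < k"
  shows "floyd_warshall d k i j \<le> floyd_warshall d k i m + floyd_warshall d k m j"
  using \<open>m < k\<close>
proof (induction k arbitrary: i j)
  case (Suc k)
  let ?f = "floyd_warshall d k"
  have nn': "0 \<le> ?f i j" for i j by (rule floyd_warshall_nonneg[OF nn])
  have self': "?f k k = 0" by (rule floyd_warshall_self[OF nn self])
  show ?case
  proof (cases "m = k")
    case True
    then show ?thesis using self' nn' by (simp add: min_def)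
  next
    case False
    then have tri: "?f i j \<le> ?f i m + ?f m j" for i j using Suc by simp
    show ?thesis
      using tri[of i j] tri[of i k] tri[of k j] tri[of k k] self' by (auto simp: min_def)
  qed
qed simp

text \<open>Every value arises from initial entries by concatenation. The lemma serves to exhibit a
  walk behind each distance below 1.\<close>

lemma floyd_warshall_invariant:
  assumes "\<And>i j. i < n \<Longrightarrow> j < n \<Longrightarrow> P i j (d i j)"
    and "\<And>i m j a b. i < n \<Longrightarrow> m < n \<Longrightarrow> j < n \<Longrightarrow> P i m a \<Longrightarrow> P m j b \<Longrightarrow> P i j (a + b)"
    and "k \<le> n" "i < n" "j < n"
  shows "P i j (floyd_warshall d k i j)"
  using assms(3-)
proof (induction k arbitrary: i j)
  case 0
  then show ?case using assms(1) by simp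
next
  case (Suc k)
  then show ?case using assms(2)[of i k j] by (auto simp: min_def)
qed

lemma nearest_cases: "nearest F d m t v = 1 \<or> (\<exists>s<m. nearest F d m t v = d s v)"
  by (induction m) (auto simp: less_Suc_eq)

text \<open>The premise \<open>\<theta> < 1\<close> keeps the default value 1 from being mistaken
  for the distance of a source.\<close>

lemma nearest_le_iff: "\<theta> < 1 \<Longrightarrow> nearest F d m t v \<le> \<theta> \<longleftrightarrow> (\<exists>s<m. F s t \<and> d s v \<le> \<theta>)"
  by (induction m) (auto simp: less_Suc_eq)

text \<open>The product rather than the least common multiple: its length is at once bounded by the
  total size of the entries.\<close>

definition common_denominator :: "nat \<Rightarrow> (nat \<Rightarrow> rat) \<Rightarrow> nat" where
  "common_denominator m u = (\<Prod>i<m. nat (snd (quotient_of (u i))))"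

lemma common_denominator_pos: "0 < common_denominator m u"
  by (auto simp: common_denominator_def quotient_of_denom_pos' intro!: prod_pos)

lemma mult_common_denominator_Ints:
  assumes "i < m"
  shows "u i * of_nat (common_denominator m u) \<in> \<int>"
proof -
  obtain a b where ab: "quotient_of (u i) = (a, b)" by force
  have b: "b > 0" using quotient_of_denom_pos[OF ab] .
  have "common_denominator m u = nat b * (\<Prod>j\<in>{..<m} - {i}. nat (snd (quotient_of (u j))))"
    using assms ab unfolding common_denominator_def by (subst prod.remove[of _ i]) auto
  then have "u i * of_nat (common_denominator m u) =
      of_int a * of_nat (\<Prod>j\<in>{..<m} - {i}. nat (snd (quotient_of (u j))))"
    using b quotient_of_div[OF ab] by (simp add: field_simps)
  then show ?thesis by (simp only: Ints_mult Ints_of_int Ints_of_nat)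
qed

lemma floorlog_common_denominator:
  "floorlog 2 (common_denominator m u) \<le> 1 + (\<Sum>i<m. rat_size (u i))"
proof -
  have "floorlog 2 (common_denominator m u) \<le> 1 + (\<Sum>i<m. floorlog 2 (nat (snd (quotient_of (u i)))))"
    unfolding common_denominator_def by (rule floorlog_prod_le) simp
  also have "\<dots> \<le> 1 + (\<Sum>i<m. rat_size (u i))"
    by (intro add_left_mono sum_mono) (auto simp: rat_size_def split: prod.splits)
  finally show ?thesis .
qed

text \<open>All partial sums share one denominator and are bounded by the sum of the numerators.
  With \<open>S\<close> the total size, \<open>4 + 3 * S\<close> is
  \<open>1 + (1 + S) + 2 * (1 + S)\<close>, for the magnitude and twice the denominator.\<close>

lemma rat_size_subset_sum_le:
  fixes u f :: "nat \<Rightarrow> rat"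
  assumes "\<And>i. i < m \<Longrightarrow> 0 \<le> u i" "\<And>i. i < m \<Longrightarrow> f i \<in> {0, 1}" "m' \<le> m"
  shows "rat_size (\<Sum>i<m'. u i * f i) \<le> 4 + 3 * (\<Sum>i<m. rat_size (u i))"
proof -
  let ?S = "\<Sum>i<m. rat_size (u i)"
  let ?num = "\<lambda>i. nat \<bar>fst (quotient_of (u i))\<bar>"
  \<comment> \<open>A product that dominates the sum of the numerators, because
    \<open>floorlog\<close> turns a product into a sum of lengths.\<close>
  define K where "K = (\<Prod>i<m. 1 + ?num i)"
  have le: "u i \<le> of_nat (?num i)" if "i < m" for i
  proof -
    obtain a b where ab: "quotient_of (u i) = (a, b)" by force
    have b: "b > 0" using quotient_of_denom_pos[OF ab] .
    have "u i = of_int a / of_int b" using quotient_of_div[OF ab] .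
    also have "\<dots> \<le> of_int \<bar>a\<bar> / of_int b" using b by (intro divide_right_mono) auto
    also have "\<dots> \<le> of_int \<bar>a\<bar> / 1" using b by (intro divide_left_mono) auto
    finally show ?thesis using ab by simp
  qed
  have sum_prod: "(\<Sum>i<m. g i) \<le> (\<Prod>i<m. 1 + g i)" for g :: "nat \<Rightarrow> nat"
  proof (induction m)
    case (Suc m)
    have "1 \<le> (\<Prod>i<m. 1 + g i)" by (simp add: Suc_leI)
    then have "g m * 1 \<le> g m * (\<Prod>i<m. 1 + g i)" by (rule mult_left_mono) simp
    moreover have "(\<Prod>i<Suc m. 1 + g i) = (\<Prod>i<m. 1 + g i) + g m * (\<Prod>i<m. 1 + g i)"
      by (simp add: algebra_simps)
    ultimately show ?case using Suc unfolding sum.lessThan_Suc by linarith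
  qed simp
  have "(\<Sum>i<m'. u i * f i) \<le> (\<Sum>i<m'. u i)"
  proof (rule sum_mono)
    fix i assume "i \<in> {..<m'}"
    then show "u i * f i \<le> u i" using assms(1,2)[of i] assms(3) by auto
  qed
  also have "\<dots> \<le> (\<Sum>i<m. u i)" using assms by (intro sum_mono2) auto
  also have "\<dots> \<le> (\<Sum>i<m. of_nat (?num i))" using le by (intro sum_mono) auto
  also have "\<dots> \<le> of_nat K" using sum_prod unfolding K_def by (simp only: of_nat_sum[symmetric] of_nat_le_iff)
  finally have up: "(\<Sum>i<m'. u i * f i) \<le> of_nat K" .
  have "0 \<le> u i * f i" if "i < m'" for i using assms(1,2)[of i] assms(3) that by auto
  then have "0 \<le> (\<Sum>i<m'. u i * f i)" by (intro sum_nonneg) simp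
  with up have abs: "\<bar>\<Sum>i<m'. u i * f i\<bar> \<le> of_nat K" by simp
  have "u i * f i * of_nat (common_denominator m u) \<in> \<int>" if "i < m'" for i
    using mult_common_denominator_Ints[of i m u] assms(2)[of i] assms(3) that by auto
  then have "(\<Sum>i<m'. u i * f i) * of_nat (common_denominator m u) \<in> \<int>"
    by (auto simp: sum_distrib_right)
  then have "rat_size (\<Sum>i<m'. u i * f i) \<le> 1 + floorlog 2 K + 2 * floorlog 2 (common_denominator m u)"
    using rat_size_le_common_denominator[OF common_denominator_pos abs] by simp
  moreover have "floorlog 2 K \<le> 1 + ?S"
  proof -
    have "floorlog 2 (1 + a) \<le> 1 + floorlog 2 a" for a
    proof (rule floorlog_leI)
      have "a < 2 ^ floorlog 2 a" by (rule floorlog_leD) auto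
      then show "1 + a < 2 ^ (1 + floorlog 2 a)" by simp
    qed auto
    then have "(\<Sum>i<m. floorlog 2 (1 + ?num i)) \<le> ?S"
      by (intro sum_mono) (fastforce simp: rat_size_def split: prod.splits intro: order_trans)
    then show ?thesis unfolding K_def using floorlog_prod_le[of "{..<m}" "\<lambda>i. 1 + ?num i"] by simp
  qed
  ultimately show ?thesis using floorlog_common_denominator[of m u] by linarith
qed

locale rounding_input = rounding_tables +
  assumes x_nonneg: "0 \<le> x i" and w_nonneg: "0 \<le> w i" and E_01: "E i \<in> {0, 1}"
    and x_outside: "i \<ge> n^2 \<Longrightarrow> x i = 0"
begin

lemma arc_length_bounds: "0 \<le> arc_length i j" "arc_length i j \<le> 1" "arc_length i i = 0"
  using x_nonneg by (auto simp: arc_length_def)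

lemma dist_step_bounds: "0 \<le> dist_step k i j" "dist_step k i j \<le> 1" "dist_step k i i = 0"
  unfolding dist_step_def using arc_length_bounds floyd_warshall_le[of arc_length k i j]
  by (auto intro: floyd_warshall_nonneg floyd_warshall_self order_trans)

lemma rat_size_one: "rat_size 0 = 2" "rat_size 1 = 3"
  by (simp_all add: rat_size_def floorlog_def)

text \<open>Sums and minima of multiples of \<open>1 / ?M\<close> are again such multiples, and all
  values stay at most 1. Hence the bound, with magnitude 1, is the same for every round
  \<open>k\<close>.\<close>

lemma rat_size_dist_step: "rat_size (dist_step k i j) \<le> 4 + 2 * (\<Sum>i<n^2. rat_size (x i))"
proof -
  let ?M = "common_denominator (n^2) x"
  have x: "x i * of_nat ?M \<in> \<int>" for i
    using mult_common_denominator_Ints[of i "n^2" x] x_outside[of i] by (cases "i < n^2") auto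
  have "dist_step k i j * of_nat ?M \<in> \<int>" for i j
    unfolding dist_step_def
  proof (induction k arbitrary: i j)
    case 0
    then show ?case using x by (auto simp: arc_length_def)
  next
    case (Suc k)
    then show ?case by (auto simp: min_def algebra_simps)
  qed
  then have "rat_size (dist_step k i j) \<le> 1 + floorlog 2 1 + 2 * floorlog 2 ?M"
    using dist_step_bounds by (intro rat_size_le_common_denominator common_denominator_pos) auto
  then show ?thesis using floorlog_common_denominator[of "n^2" x] by (simp add: floorlog_def)
qed

lemma rat_size_near_step: "rat_size (near_step k i j) \<le> 4 + 2 * (\<Sum>i<n^2. rat_size (x i))"
  using nearest_cases[of "\<lambda>s t. 0 < F (s * n + t)" dist k i j] rat_size_dist_step
  by (auto simp: near_step_def dist_def rat_size_one)

lemma flag_eq: "flag m p e = of_bool (\<exists>t<m. near_step n t (e div n) \<le> radius p \<and> radius p < near_step n t (e mod n))"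
  by (induction m) (auto simp: less_Suc_eq)

lemma rat_size_flag: "rat_size (flag m p e) \<le> 3"
  by (simp add: flag_eq rat_size_one)

lemma rat_size_weight:
  "m \<le> n^2 \<Longrightarrow> rat_size (weight m p) \<le> 4 + 3 * (\<Sum>i<n^2. rat_size (w i))"
  unfolding weight_def by (intro rat_size_subset_sum_le) (auto simp: w_nonneg flag_eq)

lemma radius_best: "radius (best m) < 1"
  by (induction m) (auto simp: radius_def dist_def dist_step_bounds)

lemma weight_best_le: "p < m \<Longrightarrow> radius p < 1 \<Longrightarrow> weight (n^2) (best m) \<le> weight (n^2) p"
proof (induction m)
  case (Suc m)
  then show ?case by (cases "p = m") auto
qed simp

end

section \<open>Running time and result of the whole program\<close>

definition rounding_program :: com where
  "rounding_program =
     Seq (fill ''id'' (Times (power_n 4) (Plus order_n (Const 1))) (Val counter))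
    (Seq (fill ''d'' (Times (power_n 2) (Plus order_n (Const 1))) distance_cexp)
    (Seq (fill ''D'' (Times (power_n 2) (Plus order_n (Const 1))) nearest_cexp)
    (Seq (fill ''flag'' (Times (power_n 4) (Plus order_n (Const 1))) flag_cexp)
    (Seq (fill ''W'' (Times (power_n 2) (Plus (power_n 2) (Const 1))) weight_cexp)
    (Seq (fill ''best'' (Plus (power_n 2) (Const 1)) best_cexp)
         (fill ''cut'' (power_n 2) cut_cexp))))))"

definition program_cost_factor :: nat where
  "program_cost_factor =
     fill_cost_factor (Times (power_n 4) (Plus order_n (Const 1))) (Val counter) +
     fill_cost_factor (Times (power_n 2) (Plus order_n (Const 1))) distance_cexp +
     fill_cost_factor (Times (power_n 2) (Plus order_n (Const 1))) nearest_cexp +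
     fill_cost_factor (Times (power_n 4) (Plus order_n (Const 1))) flag_cexp +
     fill_cost_factor (Times (power_n 2) (Plus (power_n 2) (Const 1))) weight_cexp +
     fill_cost_factor (Plus (power_n 2) (Const 1)) best_cexp +
     fill_cost_factor (power_n 2) cut_cexp"

lemma ready_filled: "ready n s \<Longrightarrow> a \<noteq> ''n'' \<Longrightarrow> a \<noteq> ''id'' \<Longrightarrow> ready n (filled s a m f)"
  by (simp add: ready_def filled_def)

context rounding_input
begin

lemma rounding_program_run:
  assumes s: "s ''n'' 0 = of_nat n" "s ''E'' = E" "s ''F'' = F" "s ''w'' = w" "s ''x'' = x"
    and bs: "bounded_store B s"
    and B: "n^4 * (n + 1) + 3 \<le> B" "4 + 2 * (\<Sum>i<n^2. rat_size (x i)) \<le> B"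
      "4 + 3 * (\<Sum>i<n^2. rat_size (w i)) \<le> B"
  shows "\<exists>t s'. big_step rounding_program s t s' \<and>
    t \<le> program_cost_factor * (n^4 * (n + 1) + 2) * B \<and>
    (\<forall>i<n^2. s' ''cut'' i = E i * flag n (best (n^2)) i)"
proof -
  let ?L = "n^4 * (n + 1)"
  have sizes: "n^2 \<le> ?L" "n^2 * (n + 1) \<le> ?L" "n^2 * (n^2 + 1) \<le> ?L"
  proof -
    have "n^a \<le> n^b" if "1 \<le> a" "a \<le> b" for a b
      using that by (cases "n = 0") (auto simp: power_0_left intro: power_increasing)
    from this[of 2 4] this[of 2 5] this[of 3 5] have le: "n^2 \<le> n^4" "n^2 \<le> n^5" "n^3 \<le> n^5" by simp_all
    have eq: "?L = n^4 + n^5" "n^2 * (n + 1) = n^2 + n^3" "n^2 * (n^2 + 1) = n^4 + n^2"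
      by (simp_all add: algebra_simps numeral_eq_Suc)
    show "n^2 \<le> ?L" "n^2 * (n + 1) \<le> ?L" "n^2 * (n^2 + 1) \<le> ?L"
      unfolding eq using le by linarith+
  qed
  have szn: "rat_size (of_nat m) \<le> B" if "m \<le> ?L + 1" for m
    using rat_size_of_nat_le[of m] that B(1) by linarith
  have step: "\<exists>t. big_step (fill a N e) s t (filled s a M f) \<and>
      t \<le> fill_cost_factor N e * (?L + 2) * B \<and> bounded_store B (filled s a M f)"
    if "bounded_store B s" "a \<noteq> ''c''"
      "\<And>m. m \<le> M \<Longrightarrow> aval N (filled s a m f) = of_nat M"
      "\<And>m. m < M \<Longrightarrow> cval e (filled s a m f) = f m"
      "\<And>m. m < M \<Longrightarrow> rat_size (f m) \<le> B" "M \<le> ?L + 1" for a N e M f s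
  proof -
    have "fill_cost_factor N e * (M + 1) * B \<le> fill_cost_factor N e * (?L + 2) * B"
      using that(6) by (intro mult_le_mono) auto
    moreover have "bounded_store B (filled s a M f)"
      using that by (intro bounded_filled szn) auto
    moreover have "M + 2 \<le> B" using that(6) B(1) by linarith
    ultimately show ?thesis
      using fill_step[OF that(1-5)] by (meson le_trans)
  qed
  have pn: "aval (power_n k) s = of_nat (n^k)" if "s ''n'' 0 = of_nat n" for s k
    using that by (rule aval_power_n)
  have N1: "aval (Times (power_n k) (Plus order_n (Const 1))) s = of_nat (n^k * (n + 1))"
    if "s ''n'' 0 = of_nat n" for s k
    by (intro aval_nat pn that) (use that in simp)
  have N2: "aval (Times (power_n 2) (Plus (power_n 2) (Const 1))) s = of_nat (n^2 * (n^2 + 1))"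
    "aval (Plus (power_n 2) (Const 1)) s = of_nat (n^2 + 1)"
    if "s ''n'' 0 = of_nat n" for s
    by (intro aval_nat pn that)+

  define s1 where "s1 = filled s ''id'' ?L of_nat"
  obtain t1 where t1: "big_step (fill ''id'' (Times (power_n 4) (Plus order_n (Const 1))) (Val counter)) s t1 s1"
    "t1 \<le> fill_cost_factor (Times (power_n 4) (Plus order_n (Const 1))) (Val counter) * (?L + 2) * B"
    and b1: "bounded_store B s1"
  proof -
    have "\<exists>t. big_step (fill ''id'' (Times (power_n 4) (Plus order_n (Const 1))) (Val counter)) s t s1 \<and>
        t \<le> fill_cost_factor (Times (power_n 4) (Plus order_n (Const 1))) (Val counter) * (?L + 2) * B \<and>
        bounded_store B s1"
      unfolding s1_def by (intro step bs N1) (use szn s(1) in \<open>auto simp: filled_apply\<close>)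
    with that show ?thesis by blast
  qed
  have r1: "ready n s1" using s by (simp add: ready_def s1_def filled_apply)
  have a1: "s1 ''E'' = E" "s1 ''F'' = F" "s1 ''w'' = w" "s1 ''x'' = x"
    using s by (simp_all add: s1_def filled_apply)
  have rn: "s ''n'' 0 = of_nat n" if "ready n s" for s using that by (simp add: ready_def)

  define s2 where "s2 = filled s1 ''d'' (n^2 * (n + 1)) dist_table"
  obtain t2 where t2: "big_step (fill ''d'' (Times (power_n 2) (Plus order_n (Const 1))) distance_cexp) s1 t2 s2"
    "t2 \<le> fill_cost_factor (Times (power_n 2) (Plus order_n (Const 1))) distance_cexp * (?L + 2) * B"
    and b2: "bounded_store B s2"
  proof -
    have "rat_size (dist_table m) \<le> B" for m
      using rat_size_dist_step B(2) order_trans unfolding dist_table_def by blast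
    then have "\<exists>t. big_step (fill ''d'' (Times (power_n 2) (Plus order_n (Const 1))) distance_cexp) s1 t s2 \<and>
        t \<le> fill_cost_factor (Times (power_n 2) (Plus order_n (Const 1))) distance_cexp * (?L + 2) * B \<and> bounded_store B s2"
      unfolding s2_def
      by (intro step b1 N1 cval_distance)
        (use r1 a1 sizes in \<open>auto simp: filled_apply ready_filled rn\<close>)
    with that show ?thesis by blast
  qed
  have r2: "ready n s2" using r1 by (simp add: ready_filled s2_def)
  have a2: "s2 ''E'' = E" "s2 ''F'' = F" "s2 ''w'' = w"
    "\<And>i. i < n^2 * (n + 1) \<Longrightarrow> s2 ''d'' i = dist_table i"
    using a1 by (simp_all add: s2_def filled_apply)

  define s3 where "s3 = filled s2 ''D'' (n^2 * (n + 1)) near_table"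
  obtain t3 where t3: "big_step (fill ''D'' (Times (power_n 2) (Plus order_n (Const 1))) nearest_cexp) s2 t3 s3"
    "t3 \<le> fill_cost_factor (Times (power_n 2) (Plus order_n (Const 1))) nearest_cexp * (?L + 2) * B"
    and b3: "bounded_store B s3"
  proof -
    have "rat_size (near_table m) \<le> B" for m
      using rat_size_near_step B(2) order_trans unfolding near_table_def by blast
    then have "\<exists>t. big_step (fill ''D'' (Times (power_n 2) (Plus order_n (Const 1))) nearest_cexp) s2 t s3 \<and>
        t \<le> fill_cost_factor (Times (power_n 2) (Plus order_n (Const 1))) nearest_cexp * (?L + 2) * B \<and> bounded_store B s3"
      unfolding s3_def
      by (intro step b2 N1 cval_nearest)
        (use r2 a2 sizes in \<open>auto simp: filled_apply ready_filled rn\<close>)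
    with that show ?thesis by blast
  qed
  have r3: "ready n s3" using r2 by (simp add: ready_filled s3_def)
  have a3: "s3 ''E'' = E" "s3 ''w'' = w"
    "\<And>i. i < n^2 * (n + 1) \<Longrightarrow> s3 ''d'' i = dist_table i"
    "\<And>i. i < n^2 * (n + 1) \<Longrightarrow> s3 ''D'' i = near_table i"
    using a2 by (simp_all add: s3_def filled_apply)

  define s4 where "s4 = filled s3 ''flag'' ?L flag_table"
  obtain t4 where t4: "big_step (fill ''flag'' (Times (power_n 4) (Plus order_n (Const 1))) flag_cexp) s3 t4 s4"
    "t4 \<le> fill_cost_factor (Times (power_n 4) (Plus order_n (Const 1))) flag_cexp * (?L + 2) * B"
    and b4: "bounded_store B s4"
  proof -
    have "rat_size (flag_table m) \<le> B" for m
      using rat_size_flag[of "m div n^4" "m div n^2 mod n^2" "m mod n^2"] B(1) unfolding flag_table_def by linarith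
    then have "\<exists>t. big_step (fill ''flag'' (Times (power_n 4) (Plus order_n (Const 1))) flag_cexp) s3 t s4 \<and>
        t \<le> fill_cost_factor (Times (power_n 4) (Plus order_n (Const 1))) flag_cexp * (?L + 2) * B \<and> bounded_store B s4"
      unfolding s4_def
      by (intro step b3 N1 cval_flag)
        (use r3 a3 sizes in \<open>auto simp: filled_apply ready_filled rn\<close>)
    with that show ?thesis by blast
  qed
  have r4: "ready n s4" using r3 by (simp add: ready_filled s4_def)
  have a4: "s4 ''E'' = E" "s4 ''w'' = w"
    "\<And>i. i < n^2 * (n + 1) \<Longrightarrow> s4 ''d'' i = dist_table i"
    "\<And>i. i < ?L \<Longrightarrow> s4 ''flag'' i = flag_table i"
    using a3 by (simp_all add: s4_def filled_apply)

  define s5 where "s5 = filled s4 ''W'' (n^2 * (n^2 + 1)) weight_table"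
  obtain t5 where t5: "big_step (fill ''W'' (Times (power_n 2) (Plus (power_n 2) (Const 1))) weight_cexp) s4 t5 s5"
    "t5 \<le> fill_cost_factor (Times (power_n 2) (Plus (power_n 2) (Const 1))) weight_cexp * (?L + 2) * B"
    and b5: "bounded_store B s5"
  proof -
    have "rat_size (weight_table m) \<le> B" if "m < n^2 * (n^2 + 1)" for m
    proof -
      have "m div n^2 < n^2 + 1" using that by (simp add: less_mult_imp_div_less mult.commute)
      then have "rat_size (weight_table m) \<le> 4 + 3 * (\<Sum>i<n^2. rat_size (w i))"
        unfolding weight_table_def by (intro rat_size_weight) simp
      with B(3) show ?thesis by linarith
    qed
    then have "\<exists>t. big_step (fill ''W'' (Times (power_n 2) (Plus (power_n 2) (Const 1))) weight_cexp) s4 t s5 \<and>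
        t \<le> fill_cost_factor (Times (power_n 2) (Plus (power_n 2) (Const 1))) weight_cexp * (?L + 2) * B \<and> bounded_store B s5"
      unfolding s5_def
      by (intro step b4 N2(1) cval_weight)
        (use r4 a4 sizes in \<open>auto simp: filled_apply ready_filled rn\<close>)
    with that show ?thesis by blast
  qed
  have r5: "ready n s5" using r4 by (simp add: ready_filled s5_def)
  have a5: "s5 ''E'' = E"
    "\<And>i. i < n^2 * (n + 1) \<Longrightarrow> s5 ''d'' i = dist_table i"
    "\<And>i. i < ?L \<Longrightarrow> s5 ''flag'' i = flag_table i"
    "\<And>i. i < n^2 * (n^2 + 1) \<Longrightarrow> s5 ''W'' i = weight_table i"
    using a4 by (simp_all add: s5_def filled_apply)

  define s6 where "s6 = filled s5 ''best'' (n^2 + 1) (\<lambda>m. of_nat (best m))"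
  obtain t6 where t6: "big_step (fill ''best'' (Plus (power_n 2) (Const 1)) best_cexp) s5 t6 s6"
    "t6 \<le> fill_cost_factor (Plus (power_n 2) (Const 1)) best_cexp * (?L + 2) * B"
    and b6: "bounded_store B s6"
  proof -
    have "rat_size (of_nat (best m)) \<le> B" if "m < n^2 + 1" for m
    proof -
      have "best m \<le> m" by (induction m) auto
      then show ?thesis using that sizes(1) by (intro szn) linarith
    qed
    then have "\<exists>t. big_step (fill ''best'' (Plus (power_n 2) (Const 1)) best_cexp) s5 t s6 \<and>
        t \<le> fill_cost_factor (Plus (power_n 2) (Const 1)) best_cexp * (?L + 2) * B \<and> bounded_store B s6"
      unfolding s6_def
      by (intro step b5 N2(2) cval_best)
        (use r5 a5 sizes in \<open>auto simp: filled_apply ready_filled rn\<close>)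
    with that show ?thesis by blast
  qed
  have r6: "ready n s6" using r5 by (simp add: ready_filled s6_def)
  have a6: "s6 ''E'' = E"
    "\<And>i. i < ?L \<Longrightarrow> s6 ''flag'' i = flag_table i"
    "\<And>i. i < n^2 + 1 \<Longrightarrow> s6 ''best'' i = of_nat (best i)"
    using a5 by (simp_all add: s6_def filled_apply)

  define s7 where "s7 = filled s6 ''cut'' (n^2) (\<lambda>m. E m * flag n (best (n^2)) m)"
  obtain t7 where t7: "big_step (fill ''cut'' (power_n 2) cut_cexp) s6 t7 s7"
    "t7 \<le> fill_cost_factor (power_n 2) cut_cexp * (?L + 2) * B"
  proof -
    have "rat_size (E m * flag n (best (n^2)) m) \<le> B" for m
      using E_01[of m] B(1) by (auto simp: flag_eq rat_size_one)
    then have "\<exists>t. big_step (fill ''cut'' (power_n 2) cut_cexp) s6 t s7 \<and>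
        t \<le> fill_cost_factor (power_n 2) cut_cexp * (?L + 2) * B \<and> bounded_store B s7"
      unfolding s7_def
      by (intro step b6 pn cval_cut)
        (use r6 a6 sizes in \<open>auto simp: filled_apply ready_filled rn\<close>)
    with that show ?thesis by blast
  qed
  have "\<forall>i<n^2. s7 ''cut'' i = E i * flag n (best (n^2)) i"
    by (simp add: s7_def filled_apply)
  moreover have "big_step rounding_program s (t1 + (t2 + (t3 + (t4 + (t5 + (t6 + t7)))))) s7"
    unfolding rounding_program_def
    by (rule big_step.Seq[OF t1(1)] big_step.Seq[OF t2(1)] big_step.Seq[OF t3(1)] big_step.Seq[OF t4(1)]
        big_step.Seq[OF t5(1)] big_step.Seq[OF t6(1) t7(1)])+
  moreover have "t1 + (t2 + (t3 + (t4 + (t5 + (t6 + t7))))) \<le> program_cost_factor * (?L + 2) * B"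
    unfolding program_cost_factor_def add_mult_distrib
    using t1(2) t2(2) t3(2) t4(2) t5(2) t6(2) t7(2) by linarith
  ultimately show ?thesis by blast
qed

end

section \<open>From the tables back to cuts of the instance\<close>

locale rational_instance =
  fixes n :: nat and G H :: "nat pair_pre_digraph" and w x :: "nat \<times> nat \<Rightarrow> rat"
  assumes inst: "multicut_instance G H (\<lambda>e. of_rat (w e))" and verts: "pverts G = {..<n}"
    and lp: "feasible_lp G H (\<lambda>e. of_rat (x e))"
begin

abbreviation "E_cells \<equiv> matrix_cells n (\<lambda>e. of_bool (e \<in> parcs G))"
abbreviation "F_cells \<equiv> matrix_cells n (\<lambda>e. of_bool (e \<in> parcs H))"
abbreviation "w_cells \<equiv> matrix_cells n (\<lambda>e. if e \<in> parcs G then w e else 0)"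
abbreviation "x_cells \<equiv> matrix_cells n (\<lambda>e. if e \<in> parcs G then x e else 0)"

lemma arc_bounds: "(i, j) \<in> parcs G \<Longrightarrow> i < n \<and> j < n" "(i, j) \<in> parcs H \<Longrightarrow> i < n \<and> j < n"
proof -
  interpret G: pair_fin_digraph G using inst by (simp add: multicut_instance_def)
  interpret H: pair_fin_digraph H using inst by (simp add: multicut_instance_def)
  show "(i, j) \<in> parcs G \<Longrightarrow> i < n \<and> j < n" "(i, j) \<in> parcs H \<Longrightarrow> i < n \<and> j < n"
    using G.wellformed' H.wellformed' verts inst by (auto simp: multicut_instance_def)
qed

lemma arc_nonneg: "e \<in> parcs G \<Longrightarrow> 0 \<le> w e" "e \<in> parcs G \<Longrightarrow> 0 \<le> x e"
  using inst lp by (auto simp: multicut_instance_def feasible_lp_def)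

lemma matrix_cells_entry:
  assumes "i < n" "j < n"
  shows "matrix_cells n f (i * n + j) = f (i, j)"
proof -
  have "i * n + j < (i + 1) * n" using assms by simp
  also have "\<dots> \<le> n * n" using assms by (intro mult_le_mono1) simp
  finally show ?thesis using assms by (simp add: matrix_cells_def)
qed

sublocale rounding_input n E_cells F_cells w_cells x_cells
  by unfold_locales (auto simp: matrix_cells_def arc_nonneg power2_eq_square)

definition real_dist :: "nat \<Rightarrow> nat \<Rightarrow> real" where
  "real_dist i j = of_rat (dist i j)"

sublocale lp_distance G H "\<lambda>e. of_rat (x e)" real_dist
proof (intro lp_distance.intro)
  fix s a b assume "s \<in> pverts G" and ab: "(a, b) \<in> parcs G"
  \<comment> \<open>After \<open>n\<close> rounds every vertex has served as an intermediate point,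
    in particular \<open>a\<close>.\<close>
  have "dist s b \<le> dist s a + dist a b"
    unfolding dist_def dist_step_def using arc_length_bounds arc_bounds(1)[OF ab]
    by (intro floyd_warshall_triangle) auto
  moreover have "dist a b \<le> arc_length a b"
    unfolding dist_def dist_step_def by (rule floyd_warshall_le)
  moreover have "arc_length a b \<le> x (a, b)"
    using arc_bounds(1)[OF ab] ab arc_nonneg(2)[OF ab] by (auto simp: arc_length_def matrix_cells_entry)
  ultimately have "dist s b \<le> dist s a + x (a, b)" by linarith
  then show "real_dist s b \<le> real_dist s a + of_rat (x (a, b))"
    unfolding real_dist_def by (simp add: of_rat_less_eq flip: of_rat_add)
next
  fix s t assume st: "(s, t) \<in> parcs H"
  \<comment> \<open>The distance of a demand has to be bounded from below: a value under 1 is backed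
    by a walk that is no longer, and the LP makes such a walk of length at least 1. Nonnegativity is
    carried along so that a summand of at least 1 keeps the sum at least 1.\<close>
  let ?P = "\<lambda>i j z. 0 \<le> z \<and> (1 \<le> z \<or> (\<exists>p. set p \<subseteq> parcs G \<and> pcas i p j \<and> sum_list (map x p) \<le> z))"
  have base: "?P i j (arc_length i j)" if ij: "i < n" "j < n" for i j
  proof -
    have "i = j \<or> arc_length i j = 1 \<or> (i, j) \<in> parcs G \<and> arc_length i j = x (i, j)"
      using ij by (simp add: arc_length_def matrix_cells_entry)
    then consider "i = j" | "arc_length i j = 1" | "(i, j) \<in> parcs G" "arc_length i j = x (i, j)"
      by blast
    then show ?thesis
    proof cases
      case 1
      then show ?thesis by (auto simp: arc_length_bounds intro!: exI[of _ "[]"])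
    next
      case 3
      then show ?thesis by (auto simp: arc_nonneg intro!: exI[of _ "[(i, j)]"])
    qed simp
  qed
  have compose: "?P i j (a + b)" if "?P i m a" "?P m j b" for i m j a b
  proof -
    have app: "pcas i (p @ q) j" if "pcas i p m" "pcas m q j" for p q
      using that by (induction p arbitrary: i) auto
    consider "1 \<le> a \<or> 1 \<le> b" | p q where "set p \<subseteq> parcs G" "pcas i p m" "sum_list (map x p) \<le> a"
      "set q \<subseteq> parcs G" "pcas m q j" "sum_list (map x q) \<le> b"
      using \<open>?P i m a\<close> \<open>?P m j b\<close> by blast
    then show ?thesis
    proof cases
      case 1
      then show ?thesis using \<open>?P i m a\<close> \<open>?P m j b\<close> by auto
    next
      case 2
      then have "set (p @ q) \<subseteq> parcs G \<and> pcas i (p @ q) j \<and> sum_list (map x (p @ q)) \<le> a + b"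
        using app by auto
      then show ?thesis using \<open>?P i m a\<close> \<open>?P m j b\<close> by (meson add_nonneg_nonneg)
    qed
  qed
  have "?P s t (floyd_warshall arc_length n s t)"
  proof (rule floyd_warshall_invariant[where P = ?P and n = n])
    show "?P i j (a + b)" if "?P i m a" "?P m j b" for i m j a b
      using that by (rule compose)
  qed (use base arc_bounds(2)[OF st] in auto)
  moreover have "1 \<le> sum_list (map x p)" if "set p \<subseteq> parcs G" "pcas s p t" for p
  proof -
    have "1 \<le> sum_list (map (\<lambda>e. of_rat (x e) :: real) p)"
      using feasible_lp_walk[OF _ lp st _ that] inst arc_bounds(2)[OF st] verts
      by (auto simp: multicut_instance_def)
    also have "\<dots> = of_rat (sum_list (map x p))"
      by (induction p) (auto simp: of_rat_add)
    finally show ?thesis by simp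
  qed
  ultimately have "1 \<le> dist s t"
    unfolding dist_def dist_step_def by force
  then show "1 \<le> real_dist s t" by (simp add: real_dist_def)
qed (use inst in \<open>auto simp: multicut_instance_def real_dist_def dist_def dist_step_bounds\<close>)

lemma flag_threshold_cut:
  assumes "radius p < 1" "i < n" "j < n"
  shows "E_cells (i * n + j) * flag n p (i * n + j) =
    of_bool ((i, j) \<in> threshold_cut G H real_dist (of_rat (radius p)))"
proof -
  have near: "near_step n t v \<le> radius p \<longleftrightarrow> (\<exists>s. (s, t) \<in> parcs H \<and> real_dist s v \<le> of_rat (radius p))"
    if "t < n" for t v
  proof -
    have "(\<exists>s<n. 0 < F_cells (s * n + t) \<and> dist s v \<le> radius p) \<longleftrightarrow>
        (\<exists>s<n. (s, t) \<in> parcs H \<and> dist s v \<le> radius p)"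
      using that by (intro ex_cong1) (auto simp: matrix_cells_entry)
    then show ?thesis
      unfolding near_step_def nearest_le_iff[OF assms(1)] real_dist_def of_rat_less_eq
      using arc_bounds(2) by blast
  qed
  have ij: "(i * n + j) div n = i" "(i * n + j) mod n = j" using assms by auto
  have "(\<exists>t<n. near_step n t i \<le> radius p \<and> radius p < near_step n t j) \<longleftrightarrow>
    (\<exists>t. (\<exists>s. (s, t) \<in> parcs H \<and> real_dist s i \<le> of_rat (radius p)) \<and>
         (\<forall>s. (s, t) \<in> parcs H \<longrightarrow> of_rat (radius p) < real_dist s j))"
  proof -
    have "near_step n t i \<le> radius p \<and> radius p < near_step n t j \<longleftrightarrow>
        (\<exists>s. (s, t) \<in> parcs H \<and> real_dist s i \<le> of_rat (radius p)) \<and>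
        (\<forall>s. (s, t) \<in> parcs H \<longrightarrow> of_rat (radius p) < real_dist s j)" if "t < n" for t
      using near[OF that, of i] near[OF that, of j] by (auto simp flip: not_le)
    then show ?thesis using arc_bounds(2) by blast
  qed
  then show ?thesis
    using assms by (simp add: flag_eq ij matrix_cells_entry threshold_cut_def)
qed

lemma weight_threshold_cut:
  assumes "radius p < 1"
  shows "of_rat (weight (n^2) p) = cut_weight (\<lambda>e. of_rat (w e)) (threshold_cut G H real_dist (of_rat (radius p)))"
proof -
  let ?C = "threshold_cut G H real_dist (of_rat (radius p))"
  have C: "?C \<subseteq> {..<n} \<times> {..<n}" using arc_bounds by (auto simp: threshold_cut_def)
  have "weight (n^2) p = (\<Sum>(i, j)\<in>{..<n} \<times> {..<n}. w_cells (i * n + j) * flag n p (i * n + j))"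
    unfolding weight_def
  proof (rule sum.reindex_bij_witness[of _ "\<lambda>(i, j). i * n + j" "\<lambda>e. (e div n, e mod n)"])
    fix e assume "e \<in> {..<n^2}"
    then show "(e div n, e mod n) \<in> {..<n} \<times> {..<n}"
      by (cases "n = 0") (auto simp: power2_eq_square less_mult_imp_div_less)
  next
    fix ij assume "ij \<in> {..<n} \<times> {..<n}"
    moreover have "i * n + j < n^2" if "i < n" "j < n" for i j
      using index3_less[of i n j 0] that by simp
    ultimately show "(case ij of (i, j) \<Rightarrow> i * n + j) \<in> {..<n^2}" by auto
  qed auto
  also have "\<dots> = (\<Sum>e\<in>{..<n} \<times> {..<n}. if e \<in> ?C then w e else 0)"
  proof (rule sum.cong[OF refl])
    fix e assume "e \<in> {..<n} \<times> {..<n}"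
    then obtain i j where e: "e = (i, j)" and ij: "i < n" "j < n" by auto
    have "w_cells (i * n + j) * flag n p (i * n + j) =
      w (i, j) * (E_cells (i * n + j) * flag n p (i * n + j))"
      using ij by (simp add: matrix_cells_entry)
    also have "\<dots> = (if (i, j) \<in> ?C then w (i, j) else 0)"
      using flag_threshold_cut[OF assms] ij by simp
    finally show "(case e of (i, j) \<Rightarrow> w_cells (i * n + j) * flag n p (i * n + j)) =
        (if e \<in> ?C then w e else 0)" by (simp add: e)
  qed
  also have "\<dots> = (\<Sum>e\<in>({..<n} \<times> {..<n}) \<inter> ?C. w e)" by (simp add: sum.inter_restrict)
  also have "({..<n} \<times> {..<n}) \<inter> ?C = ?C" using C by blast
  finally show ?thesis by (simp add: cut_weight_def of_rat_sum)
qed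

text \<open>Replace \<open>\<theta>\<close> by the largest distance not exceeding it, which exists
  because 0 is a distance. No distance lies in between, so every comparison that defines the cut has
  the same outcome.\<close>

lemma threshold_cut_radius:
  assumes \<theta>: "0 \<le> \<theta>" "\<theta> < 1" and n: "n > 0"
  shows "\<exists>p<n^2. radius p < 1 \<and> threshold_cut G H real_dist (of_rat (radius p)) = threshold_cut G H real_dist \<theta>"
proof -
  let ?A = "{p. p < n^2 \<and> of_rat (radius p) \<le> \<theta>}"
  have "radius 0 = 0" by (simp add: radius_def dist_def dist_step_bounds)
  then have "0 \<in> ?A" using n \<theta> by auto
  then have ne: "?A \<noteq> {}" by blast
  have fin: "finite ?A" by simp
  then have "Max (radius ` ?A) \<in> radius ` ?A" using ne by (intro Max_in) auto
  then obtain p where p: "p \<in> ?A" and "Max (radius ` ?A) = radius p" by blast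
  then have p_max: "radius p' \<le> radius p" if "p' \<in> ?A" for p'
    using Max_ge[of "radius ` ?A" "radius p'"] fin that by simp
  have "real_dist i j \<le> of_rat (radius p) \<longleftrightarrow> real_dist i j \<le> \<theta>" if "i < n" "j < n" for i j
  proof -
    have "i * n + j < n^2" using index3_less[of i n j 0] that by simp
    moreover have r: "radius (i * n + j) = dist i j" using that by (simp add: radius_def)
    ultimately have "dist i j \<le> radius p" if "real_dist i j \<le> \<theta>"
      using p_max[of "i * n + j"] that by (simp add: real_dist_def)
    moreover have "real_dist i j \<le> \<theta>" if "dist i j \<le> radius p"
    proof -
      have "real_dist i j \<le> of_rat (radius p)" using that by (simp add: real_dist_def of_rat_less_eq)
      with p show ?thesis by simp
    qed
    ultimately show ?thesis by (auto simp: real_dist_def of_rat_less_eq)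
  qed
  then have "threshold_cut G H real_dist (of_rat (radius p)) = threshold_cut G H real_dist \<theta>"
    unfolding threshold_cut_def using arc_bounds by (simp add: set_eq_iff flip: not_le) blast
  moreover have "radius p < 1"
  proof -
    have "of_rat (radius p) \<le> \<theta>" using p by simp
    then have "of_rat (radius p) < (1 :: real)" using \<theta>(2) by linarith
    then show ?thesis by simp
  qed
  ultimately show ?thesis using p by auto
qed

lemma best_cut_weight_le:
  assumes k: "k \<ge> 1" and free: "\<not> has_induced_matching_extension k H"
  shows "cut_weight (\<lambda>e. of_rat (w e)) (threshold_cut G H real_dist (of_rat (radius (best (n^2)))))
    \<le> (real k - 1) * lp_cost G (\<lambda>e. of_rat (w e)) (\<lambda>e. of_rat (x e))"
proof -
  let ?C = "threshold_cut G H real_dist"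
  obtain \<theta> where \<theta>: "0 \<le> \<theta>" "\<theta> < 1" and
    le: "cut_weight (\<lambda>e. of_rat (w e)) (?C \<theta>) \<le> (real k - 1) * lp_cost G (\<lambda>e. of_rat (w e)) (\<lambda>e. of_rat (x e))"
    using cheap_threshold_exists[OF _ k free, of "\<lambda>e. of_rat (w e)"] arc_nonneg by auto
  have "cut_weight (\<lambda>e. of_rat (w e) :: real) (?C (of_rat (radius (best (n^2))))) \<le> cut_weight (\<lambda>e. of_rat (w e)) (?C \<theta>)"
  proof (cases "n = 0")
    case True
    then have "?C \<theta>' = {}" for \<theta>' using arc_bounds(1) by (auto simp: threshold_cut_def)
    then show ?thesis by simp
  next
    case False
    then obtain p where p: "p < n^2" "radius p < 1" "?C (of_rat (radius p)) = ?C \<theta>"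
      using threshold_cut_radius[OF \<theta>] by auto
    have "(of_rat (weight (n^2) (best (n^2))) :: real) \<le> of_rat (weight (n^2) p)"
      using weight_best_le p by (simp add: of_rat_less_eq)
    then show ?thesis
      using weight_threshold_cut[OF p(2)] weight_threshold_cut[OF radius_best] p(3) by simp
  qed
  with le show ?thesis by linarith
qed

text \<open>Each of the \<open>n^2\<close> cells of a matrix has size at least 1. So
  \<open>n\<close> is bounded by the input size, and time polynomial in \<open>n\<close> is
  polynomial in the input.\<close>

lemma input_size_ge:
  "n \<le> input_size n G H w x" "(\<Sum>i<n^2. rat_size (x_cells i)) \<le> input_size n G H w x"
  "(\<Sum>i<n^2. rat_size (w_cells i)) \<le> input_size n G H w x"
proof -
  have eq: "input_size n G H w x = rat_size (of_nat n) + ((\<Sum>i<n^2. rat_size (E_cells i)) +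
      (\<Sum>i<n^2. rat_size (F_cells i)) + (\<Sum>i<n^2. rat_size (w_cells i)) + (\<Sum>i<n^2. rat_size (x_cells i)))"
    by (simp add: input_size_def input_store_def Let_def power2_eq_square)
  have "n^2 = (\<Sum>i<n^2. 1)" by simp
  also have "\<dots> \<le> (\<Sum>i<n^2. rat_size (E_cells i))" by (intro sum_mono rat_size_pos)
  finally have "n^2 \<le> input_size n G H w x" using eq by simp
  moreover have "n \<le> n^2" by (simp add: power2_eq_square)
  ultimately show "n \<le> input_size n G H w x" by simp
  show "(\<Sum>i<n^2. rat_size (x_cells i)) \<le> input_size n G H w x"
    "(\<Sum>i<n^2. rat_size (w_cells i)) \<le> input_size n G H w x"
    using eq by simp_all
qed

lemma input_store_bounded:
  assumes "input_size n G H w x + 3 \<le> B"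
  shows "bounded_store B (input_store n G H w x r)"
proof -
  \<comment> \<open>The margin 3 in the premise covers \<open>rat_size 1 = 3\<close> and
    \<open>rat_size (of_nat n) \<le> n + 2\<close>.\<close>
  have small: "rat_size 0 \<le> B" "rat_size 1 \<le> B" "rat_size (of_nat n) \<le> B"
    using assms input_size_ge(1) rat_size_of_nat_le[of n] by (auto simp: rat_size_one)
  have "rat_size (w_cells i) \<le> B" "rat_size (x_cells i) \<le> B" for i
  proof -
    have *: "rat_size (u i) \<le> (\<Sum>i<n^2. rat_size (u i))" if "i < n^2" for u :: "nat \<Rightarrow> rat"
      using that by (intro member_le_sum) auto
    have **: "w_cells i = 0" "x_cells i = 0" if "\<not> i < n^2"
      using that by (simp_all add: matrix_cells_def power2_eq_square)
    show "rat_size (w_cells i) \<le> B"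
      using *[of w_cells] **(1) small(1) input_size_ge(3) assms by (cases "i < n^2") (auto intro: order_trans)
    show "rat_size (x_cells i) \<le> B"
      using *[of x_cells] **(2) small(1) input_size_ge(2) assms by (cases "i < n^2") (auto intro: order_trans)
  qed
  moreover have "rat_size (E_cells i) \<le> B" "rat_size (F_cells i) \<le> B" for i
    using small by (auto simp: matrix_cells_def)
  ultimately show ?thesis
    using small unfolding bounded_store_def input_store_def by (auto simp: fun_upd_apply)
qed

lemma rounding_program_correct:
  defines "S \<equiv> input_size n G H w x"
  shows "\<exists>t s. big_step rounding_program (input_store n G H w x r) t s \<and>
    t \<le> program_cost_factor * (S^4 * (S + 1) + 2) * (S^4 * (S + 1) + 3 * S + 4) \<and>
    output_arcs n s = threshold_cut G H real_dist (of_rat (radius (best (n^2))))"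
proof -
  \<comment> \<open>Large enough for the loop bounds, for the distances, for the partial weights and
    for the initial store at once.\<close>
  let ?B = "S^4 * (S + 1) + 3 * S + 4"
  have "n \<le> S" using input_size_ge(1) by (simp add: S_def)
  then have nS: "n^4 * (n + 1) \<le> S^4 * (S + 1)" by (intro mult_le_mono power_mono) auto
  have "bounded_store ?B (input_store n G H w x r)"
    by (rule input_store_bounded) (simp flip: S_def)
  then obtain t s where run: "big_step rounding_program (input_store n G H w x r) t s"
    and t: "t \<le> program_cost_factor * (n^4 * (n + 1) + 2) * ?B"
    and cut: "\<forall>i<n^2. s ''cut'' i = E_cells i * flag n (best (n^2)) i"
    using rounding_program_run[of "input_store n G H w x r" ?B] nS input_size_ge(2,3)
    unfolding S_def[symmetric] by (auto simp: input_store_def)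
  have "program_cost_factor * (n^4 * (n + 1) + 2) * ?B \<le> program_cost_factor * (S^4 * (S + 1) + 2) * ?B"
    using nS by (intro mult_le_mono) auto
  with t have t': "t \<le> program_cost_factor * (S^4 * (S + 1) + 2) * ?B" by linarith
  let ?C = "threshold_cut G H real_dist (of_rat (radius (best (n^2))))"
  have "s ''cut'' (i * n + j) = of_bool ((i, j) \<in> ?C)" if "i < n" "j < n" for i j
    using cut flag_threshold_cut[OF radius_best that] index3_less[of i n j 0] that by simp
  moreover have "i < n \<and> j < n" if "(i, j) \<in> ?C" for i j
    using that arc_bounds by (auto simp: threshold_cut_def)
  ultimately have "output_arcs n s = ?C" unfolding output_arcs_def by auto
  with run t' show ?thesis by blast
qed

end

lemma rounding_program_rounds:
  assumes "k \<ge> 2"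
  shows "randomized_poly_time_rounding (\<lambda>H. \<not> has_induced_matching_extension k H) (real k - 1) rounding_program"
  unfolding randomized_poly_time_rounding_def
proof (intro exI allI impI, elim conjE)
  \<comment> \<open>Here \<open>[:0, 1:]\<close> is the variable \<open>S\<close>, so this is
    \<open>S^4 * (S + 1)\<close>; below, \<open>[:4, 3:]\<close> is
    \<open>4 + 3 * S\<close>.\<close>
  let ?S4 = "[:0, 1:] ^ 4 * [:1, 1:] :: nat poly"
  let ?p = "[:program_cost_factor:] * (?S4 + [:2:]) * (?S4 + [:4, 3:])"
  fix n :: nat and G H :: "nat pair_pre_digraph" and w x :: "nat \<times> nat \<Rightarrow> rat"
  assume "multicut_instance G H (\<lambda>e. of_rat (w e))" "pverts G = {..<n}"
    "feasible_lp G H (\<lambda>e. of_rat (x e))" and free: "\<not> has_induced_matching_extension k H"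
  then interpret rational_instance n G H w x by unfold_locales
  let ?C = "threshold_cut G H real_dist (of_rat (radius (best (n^2))))"
  let ?S = "input_size n G H w x"
  have q: "poly ?p ?S = program_cost_factor * (?S^4 * (?S + 1) + 2) * (?S^4 * (?S + 1) + 3 * ?S + 4)"
    by (simp add: algebra_simps)
  have "feasible_multicut G H ?C"
    using radius_best[of "n^2"] dist_step_bounds
    by (intro threshold_cut_feasible) (auto simp: radius_def dist_def)
  moreover have "cut_weight (\<lambda>e. of_rat (w e)) ?C \<le> (real k - 1) * lp_cost G (\<lambda>e. of_rat (w e)) (\<lambda>e. of_rat (x e))"
    using assms by (intro best_cut_weight_le free) simp
  moreover have "\<exists>t s. big_step rounding_program (input_store n G H w x r) t s \<and> t \<le> poly ?p ?S \<and>
      ?C = output_arcs n s" for r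
    using rounding_program_correct[of r] unfolding q by metis
  \<comment> \<open>The witness is the same cut for all strings of random bits, so the expectation
    is just its weight.\<close>
  ultimately show "let q = poly ?p ?S in \<exists>cut. (\<forall>r. length r = q \<longrightarrow>
      (\<exists>t s. big_step rounding_program (input_store n G H w x r) t s \<and> t \<le> q \<and> cut r = output_arcs n s) \<and>
      feasible_multicut G H (cut r)) \<and>
    measure_pmf.expectation (pmf_of_set {r. length r = q}) (\<lambda>r. cut_weight (\<lambda>e. of_rat (w e)) (cut r))
      \<le> (real k - 1) * lp_cost G (\<lambda>e. of_rat (w e)) (\<lambda>e. of_rat (x e))"
    unfolding Let_def by (intro exI[of _ "\<lambda>_. ?C"]) (simp del: poly_mult poly_add)
qed

theorem theorem4:
  fixes k :: nat
  assumes "k \<ge> 2"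
  shows "(\<forall>(G :: 'a pair_pre_digraph) H w.
            multicut_instance G H w \<and> \<not> has_induced_matching_extension k H \<longrightarrow>
            flow_cut_gap G H w \<le> ereal (real k - 1)) \<and>
         (\<exists>c. randomized_poly_time_rounding
                (\<lambda>H. \<not> has_induced_matching_extension k H) (real k - 1) c)"
  using flow_cut_gap_le[OF assms] rounding_program_rounds[OF assms] by blast

end
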